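(* Let $p$ be a positive real number. The probability measure on $\mathbb{R}$ corresponding to the Jacobi sequence $\{n^p\}_{n=1}^\infty$ is unique if and only if $p\le 2$.
   Context: A (Borel) probability measure $\mu$ on $\mathbb{R}$ with infinite support and finite moments $M_n=\int_{\mathbb{R}}x^n\,d\mu$ of all orders corresponds to the Jacobi sequence $\{\omega_n\}_{n=1}^\infty$, $\omega_n>0$, if its monic orthogonal polynomials $P_0=1,P_1,P_2,\dots$ satisfy $xP_n(x)=P_{n+1}(x)+\omega_nP_{n-1}(x)$ for all $n\ge 0$, with the convention $P_{-1}=0$. Here $\omega_n=n^p$. *)

theory Defs
  imports "HOL-Probability.Probability" "HOL-Computational_Algebra.Polynomial"
begin

definition measure_support :: "real measure \<Rightarrow> real set" where
  "measure_support \<mu> = {x. \<forall>U. open U \<and> x \<in> U \<longrightarrow> emeasure \<mu> U > 0}"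

(* With all moments finite, the integrands below are integrable; the default value 0 of
   the Bochner integral for non-integrable functions therefore plays no role. *)
definition monic_orthogonal_polys :: "real measure \<Rightarrow> (nat \<Rightarrow> real poly) \<Rightarrow> bool" where
  "monic_orthogonal_polys \<mu> P \<longleftrightarrow>
     (\<forall>n. degree (P n) = n \<and> lead_coeff (P n) = 1) \<and>
     (\<forall>m n. m \<noteq> n \<longrightarrow> (\<integral>x. poly (P m) x * poly (P n) x \<partial>\<mu>) = 0)"

(* The Jacobi sequence is indexed from 1: the value \<omega> 0 is never used, because its
   coefficient P_{-1} is 0 by convention. Since the support is infinite, the sequence P of
   monic orthogonal polynomials is uniquely determined by \<mu>, so the existential quantifier
   merely names it. *)
definition corresponds_to_jacobi :: "real measure \<Rightarrow> (nat \<Rightarrow> real) \<Rightarrow> bool" where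
  "corresponds_to_jacobi \<mu> \<omega> \<longleftrightarrow>
     real_distribution \<mu> \<and>
     infinite (measure_support \<mu>) \<and>
     (\<forall>n::nat. integrable \<mu> (\<lambda>x. x ^ n)) \<and>
     (\<forall>n\<ge>1. \<omega> n > 0) \<and>
     (\<exists>P. monic_orthogonal_polys \<mu> P \<and>
          (\<forall>n. [:0, 1:] * P n =
                 P (Suc n) + (if n = 0 then 0 else smult (\<omega> n) (P (n - 1)))))"

end

theory Submission
  imports Defs "HOL-Computational_Algebra.Fundamental_Theorem_Algebra"
begin

text \<open>The Jacobi sequence determines all moments of a corresponding measure, by expanding \<open>x\<^sup>n\<close> in the
polynomials \<open>P\<^sub>k\<close> (\<open>corresponds_to_jacobi_moments\<close>). So the theorem is about existence and
determinacy in the Hamburger moment problem with \<open>\<omega>\<^sub>n = n\<^sup>p\<close>.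

Existence: the zeros of \<open>P\<^sub>n\<^sub>+\<^sub>1 - t P\<^sub>n\<close> are real and simple by the Christoffel-Darboux identity, and
they are the nodes of a Gauss quadrature rule that reproduces the orthogonality relations up to
degree \<open>n\<close> (\<open>gauss_quadrature\<close>). A weak limit of these discrete measures has the required moments.
By the choice of \<open>t\<close> an arbitrary real number \<open>x\<close> becomes a node. Its weight is \<open>1 / K\<^sub>n(x, x)\<close>, where
\<open>K\<^sub>n\<close> is the Christoffel-Darboux kernel, so if \<open>K\<^sub>n(x, x)\<close> stays bounded as \<open>n\<close> grows, then the
limit has an atom at \<open>x\<close> (\<open>corresponds_to_jacobi_exists_atom\<close>).

For \<open>p > 2\<close> the sequence is log-concave and the series of the \<open>1 / sqrt \<omega>\<^sub>n\<close> converges, and this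
bounds \<open>K\<^sub>n(x, x)\<close> for every real \<open>x\<close> (\<open>cd_kernel_bounded\<close>). A unique solution would then have an
atom at every real number, which is impossible for a finite measure.

For \<open>p \<le> 2\<close> one has \<open>\<omega>\<^sub>n \<le> n\<^sup>2\<close>, and the expansion coefficients, hence the \<open>n\<close>-th moments, are at most
\<open>3\<^sup>n n!\<close> (\<open>jacobi_expansion_bound\<close>). Two measures with equal moments of this growth have characteristic
functions that agree near \<open>0\<close> by Taylor expansion, and the agreement propagates along the real line
in steps of fixed length (\<open>moment_determinate\<close>).\<close>

section \<open>Polynomials of a Jacobi sequence\<close>

text \<open>The polynomials are defined over an arbitrary commutative ring because the zeros of the real
ones are found by evaluating their complex versions.\<close>

fun jacobi_poly :: "(nat \<Rightarrow> 'a::comm_ring_1) \<Rightarrow> nat \<Rightarrow> 'a poly" where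
  "jacobi_poly \<omega> 0 = 1"
| "jacobi_poly \<omega> (Suc 0) = [:0, 1:]"
| "jacobi_poly \<omega> (Suc (Suc n)) =
     [:0, 1:] * jacobi_poly \<omega> (Suc n) - smult (\<omega> (Suc n)) (jacobi_poly \<omega> n)"

text \<open>This product is the squared norm \<open>\<integral> P\<^sub>n\<^sup>2\<close> for every measure with Jacobi sequence \<open>\<omega>\<close>.\<close>

definition jacobi_norm :: "(nat \<Rightarrow> 'a::comm_ring_1) \<Rightarrow> nat \<Rightarrow> 'a" where
  "jacobi_norm \<omega> n = (\<Prod>k=1..n. \<omega> k)"

text \<open>The reproducing kernel of the polynomials of degree at most \<open>n\<close>, also called the
Christoffel-Darboux kernel.\<close>

definition cd_kernel :: "(nat \<Rightarrow> 'a::field) \<Rightarrow> nat \<Rightarrow> 'a \<Rightarrow> 'a \<Rightarrow> 'a" where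
  "cd_kernel \<omega> n x y =
     (\<Sum>k\<le>n. poly (jacobi_poly \<omega> k) x * poly (jacobi_poly \<omega> k) y / jacobi_norm \<omega> k)"

lemma jacobi_norm_0 [simp]: "jacobi_norm \<omega> 0 = 1"
  and jacobi_norm_Suc [simp]: "jacobi_norm \<omega> (Suc n) = \<omega> (Suc n) * jacobi_norm \<omega> n"
  by (simp_all add: jacobi_norm_def mult.commute)

lemma jacobi_norm_pos:
  fixes \<omega> :: "nat \<Rightarrow> real"
  assumes "\<forall>k\<ge>1. \<omega> k > 0"
  shows "jacobi_norm \<omega> n > 0"
  by (induction n) (auto simp: assms)

lemma jacobi_poly_three_term:
  "[:0, 1:] * jacobi_poly \<omega> n =
     jacobi_poly \<omega> (Suc n) + (if n = 0 then 0 else smult (\<omega> n) (jacobi_poly \<omega> (n - 1)))"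
  by (cases n) simp_all

lemma jacobi_poly_degree_lead:
  fixes \<omega> :: "nat \<Rightarrow> 'a::idom"
  shows "degree (jacobi_poly \<omega> n) = n \<and> lead_coeff (jacobi_poly \<omega> n) = 1"
proof (induction \<omega> n rule: jacobi_poly.induct)
  case (3 \<omega> n)
  let ?Q = "[:0, 1:] * jacobi_poly \<omega> (Suc n)" and ?R = "- smult (\<omega> (Suc n)) (jacobi_poly \<omega> n)"
  have nz: "jacobi_poly \<omega> (Suc n) \<noteq> 0" using 3 by auto
  then have dQ: "degree ?Q = Suc (Suc n)" using 3 by (simp add: degree_mult_eq)
  have "degree ?R \<le> degree (jacobi_poly \<omega> n)" by (simp add: degree_smult_le)
  then have dR: "degree ?R < degree ?Q" using 3 dQ by simp
  have l1: "lead_coeff (jacobi_poly \<omega> (Suc n)) = 1" using 3 by blast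
  have lQ: "lead_coeff ?Q = 1" unfolding lead_coeff_mult l1 by simp
  have "degree (?Q + ?R) = Suc (Suc n)" using dR dQ by (metis degree_add_eq_left)
  moreover have "lead_coeff (?Q + ?R) = 1"
    using dR lQ by (metis lead_coeff_add_le add.commute)
  ultimately show ?case by simp
qed (auto simp del: mult_pCons_left)

lemma degree_jacobi_poly [simp]:
  fixes \<omega> :: "nat \<Rightarrow> 'a::idom"
  shows "degree (jacobi_poly \<omega> n) = n"
  using jacobi_poly_degree_lead by blast

lemma jacobi_poly_monic [simp]:
  fixes \<omega> :: "nat \<Rightarrow> 'a::idom"
  shows "coeff (jacobi_poly \<omega> n) n = 1"
  using jacobi_poly_degree_lead[of \<omega> n] by simp

lemma jacobi_poly_nonzero [simp]:
  fixes \<omega> :: "nat \<Rightarrow> 'a::idom"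
  shows "jacobi_poly \<omega> n \<noteq> 0"
  using jacobi_poly_monic[of \<omega> n] by fastforce

lemma jacobi_poly_unique:
  assumes "P 0 = 1"
    and "\<And>n. [:0, 1:] * P n = P (Suc n) + (if n = 0 then 0 else smult (\<omega> n) (P (n - 1)))"
  shows "P n = jacobi_poly \<omega> n"
proof (induction n rule: less_induct)
  case (less n)
  show ?case
  proof (cases n)
    case 0 then show ?thesis using assms by simp
  next
    case (Suc m)
    then have "P n = [:0, 1:] * P m - (if m = 0 then 0 else smult (\<omega> m) (P (m - 1)))"
      using assms(2)[of m] by (simp add: algebra_simps)
    also have "\<dots> = [:0, 1:] * jacobi_poly \<omega> m
        - (if m = 0 then 0 else smult (\<omega> m) (jacobi_poly \<omega> (m - 1)))"
      using less.IH[of m] less.IH[of "m - 1"] Suc by simp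
    also have "\<dots> = jacobi_poly \<omega> n"
      using jacobi_poly_three_term[of \<omega> m] Suc by (simp add: algebra_simps)
    finally show ?thesis .
  qed
qed

lemma jacobi_poly_lincomb_eq_0:
  fixes \<omega> :: "nat \<Rightarrow> 'a::idom"
  assumes "(\<Sum>k<n. smult (a k) (jacobi_poly \<omega> k)) = 0" and "k < n"
  shows "a k = 0"
  using assms
proof (induction n)
  case (Suc n)
  have "coeff (\<Sum>k<n. smult (a k) (jacobi_poly \<omega> k)) n = 0"
    by (simp add: coeff_sum coeff_eq_0)
  then have "a n = coeff (\<Sum>k<Suc n. smult (a k) (jacobi_poly \<omega> k)) n" by simp
  also have "\<dots> = 0" unfolding Suc.prems(1) by simp
  finally have "a n = 0" .
  then show ?case using Suc by (cases "k = n") auto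
qed simp

lemma jacobi_poly_span:
  fixes f :: "'a::idom poly"
  assumes "degree f < n"
  obtains a where "f = (\<Sum>k<n. smult (a k) (jacobi_poly \<omega> k))"
  using assms
proof (induction n arbitrary: f thesis)
  case (Suc n)
  define g where "g = f - smult (coeff f n) (jacobi_poly \<omega> n)"
  have g: "degree g \<le> n" using Suc.prems unfolding g_def
    by (intro degree_diff_le) (auto intro: order.trans[OF degree_smult_le])
  have c0: "coeff g n = 0" by (simp add: g_def)
  show ?case
  proof (cases "n = 0")
    case True
    have "g = 0" using g c0 True by (metis le_zero_eq leading_coeff_0_iff)
    then have "f = (\<Sum>k<Suc n. smult (coeff f 0) (jacobi_poly \<omega> k))"
      using True by (simp add: g_def)
    then show ?thesis by (rule Suc.prems(1))
  next
    case False
    then have "degree g < n" using g c0 by (metis le_neq_implies_less leading_coeff_0_iff degree_0 gr0I)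
    then obtain a where a: "g = (\<Sum>k<n. smult (a k) (jacobi_poly \<omega> k))" using Suc.IH by blast
    have "(\<Sum>k<n. smult ((a(n := coeff f n)) k) (jacobi_poly \<omega> k)) = g"
      unfolding a by (intro sum.cong) auto
    then have "f = (\<Sum>k<Suc n. smult ((a(n := coeff f n)) k) (jacobi_poly \<omega> k))"
      by (simp add: g_def)
    then show ?thesis by (rule Suc.prems(1))
  qed
qed simp

lemma poly_jacobi_poly_of_real:
  "poly (jacobi_poly (\<lambda>k. of_real (\<omega> k) :: complex) n) (of_real x)
     = of_real (poly (jacobi_poly \<omega> n) x)"
  by (induction \<omega> n rule: jacobi_poly.induct) (simp_all del: of_real_mult add: of_real_mult[symmetric])

lemma poly_jacobi_poly_cnj:
  "poly (jacobi_poly (\<lambda>k. of_real (\<omega> k) :: complex) n) (cnj z)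
     = cnj (poly (jacobi_poly (\<lambda>k. of_real (\<omega> k)) n) z)"
  by (induction \<omega> n rule: jacobi_poly.induct) simp_all

lemma jacobi_norm_of_real:
  "jacobi_norm (\<lambda>k. of_real (\<omega> k) :: complex) n = of_real (jacobi_norm \<omega> n)"
  by (simp add: jacobi_norm_def)

section \<open>The Christoffel-Darboux identities\<close>

text \<open>The recurrences at \<open>x\<close> and at \<open>y\<close> share the coefficient \<open>\<omega>\<close>, so cross-multiplying them cancels
everything but the factor \<open>x - y\<close>. For complex \<open>\<omega>\<close> the identity is applied to \<open>y = cnj x\<close>.\<close>

lemma christoffel_darboux:
  assumes "\<forall>k\<ge>1. \<omega> k \<noteq> 0"
  shows "(x - y) * cd_kernel \<omega> n x y * jacobi_norm \<omega> n =
    poly (jacobi_poly \<omega> (Suc n)) x * poly (jacobi_poly \<omega> n) y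
    - poly (jacobi_poly \<omega> n) x * poly (jacobi_poly \<omega> (Suc n)) y"
proof (induction n)
  case 0 then show ?case by (simp add: cd_kernel_def)
next
  case (Suc n)
  let ?p = "\<lambda>k. poly (jacobi_poly \<omega> k) x" and ?q = "\<lambda>k. poly (jacobi_poly \<omega> k) y"
  have "jacobi_norm \<omega> (Suc n) \<noteq> 0" using assms by (simp add: jacobi_norm_def)
  then have "(x - y) * cd_kernel \<omega> (Suc n) x y * jacobi_norm \<omega> (Suc n)
      = \<omega> (Suc n) * ((x - y) * cd_kernel \<omega> n x y * jacobi_norm \<omega> n)
        + (x - y) * ?p (Suc n) * ?q (Suc n)"
    by (simp add: cd_kernel_def field_simps)
  also have "\<dots> = ?p (Suc (Suc n)) * ?q (Suc n) - ?p (Suc n) * ?q (Suc (Suc n))"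
    unfolding Suc.IH by (simp add: algebra_simps)
  finally show ?case .
qed

text \<open>The limit \<open>y \<rightarrow> x\<close> of the Christoffel-Darboux identity, obtained from the differentiated recurrence
instead of by a limit so that it holds over any field.\<close>

lemma christoffel_darboux_confluent:
  fixes \<omega> :: "nat \<Rightarrow> 'a::field"
  assumes "\<forall>k\<ge>1. \<omega> k \<noteq> 0"
  shows "cd_kernel \<omega> n x x * jacobi_norm \<omega> n =
    poly (pderiv (jacobi_poly \<omega> (Suc n))) x * poly (jacobi_poly \<omega> n) x
    - poly (pderiv (jacobi_poly \<omega> n)) x * poly (jacobi_poly \<omega> (Suc n)) x"
proof (induction n)
  case 0 then show ?case by (simp add: cd_kernel_def pderiv_pCons)
next
  case (Suc n)
  let ?p = "\<lambda>k. poly (jacobi_poly \<omega> k) x" and ?q = "\<lambda>k. poly (pderiv (jacobi_poly \<omega> k)) x"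
  have "jacobi_norm \<omega> (Suc n) \<noteq> 0" using assms by (simp add: jacobi_norm_def)
  then have "cd_kernel \<omega> (Suc n) x x * jacobi_norm \<omega> (Suc n)
      = \<omega> (Suc n) * (cd_kernel \<omega> n x x * jacobi_norm \<omega> n) + ?p (Suc n) * ?p (Suc n)"
    by (simp add: cd_kernel_def field_simps)
  also have "\<dots> = ?q (Suc (Suc n)) * ?p (Suc n) - ?q (Suc n) * ?p (Suc (Suc n))"
    unfolding Suc.IH by (simp add: pderiv_diff pderiv_smult pderiv_pCons algebra_simps)
  finally show ?case .
qed

lemma cd_kernel_ge_1:
  fixes \<omega> :: "nat \<Rightarrow> real"
  assumes "\<forall>k\<ge>1. \<omega> k > 0"
  shows "cd_kernel \<omega> n x x \<ge> 1"
proof -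
  have "cd_kernel \<omega> n x x \<ge> (\<Sum>k\<in>{0}. poly (jacobi_poly \<omega> k) x * poly (jacobi_poly \<omega> k) x / jacobi_norm \<omega> k)"
    unfolding cd_kernel_def
    by (intro sum_mono2) (auto intro!: divide_nonneg_pos jacobi_norm_pos assms)
  then show ?thesis by simp
qed

lemma jacobi_poly_no_common_root:
  fixes \<omega> :: "nat \<Rightarrow> real"
  assumes "\<forall>k\<ge>1. \<omega> k > 0"
  shows "poly (jacobi_poly \<omega> n) x \<noteq> 0 \<or> poly (jacobi_poly \<omega> (Suc n)) x \<noteq> 0"
proof -
  have "cd_kernel \<omega> n x x * jacobi_norm \<omega> n > 0"
    using cd_kernel_ge_1[OF assms, where n = n and x = x] jacobi_norm_pos[OF assms, where n = n]
    by (intro mult_pos_pos) auto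
  then show ?thesis
    using christoffel_darboux_confluent[of \<omega> n x] assms by fastforce
qed

section \<open>Gauss quadrature\<close>

text \<open>The free parameter \<open>t\<close> is what allows a Gauss rule to have a prescribed point among its nodes.\<close>

definition quasi_jacobi_poly :: "(nat \<Rightarrow> 'a::comm_ring_1) \<Rightarrow> 'a \<Rightarrow> nat \<Rightarrow> 'a poly" where
  "quasi_jacobi_poly \<omega> t n = jacobi_poly \<omega> (Suc n) - smult t (jacobi_poly \<omega> n)"

lemma degree_quasi_jacobi_poly:
  fixes \<omega> :: "nat \<Rightarrow> 'a::idom"
  shows "degree (quasi_jacobi_poly \<omega> t n) = Suc n"
proof -
  have "degree (- smult t (jacobi_poly \<omega> n)) < degree (jacobi_poly \<omega> (Suc n))"
    using degree_smult_le[of t "jacobi_poly \<omega> n"] by simp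
  then have "degree (jacobi_poly \<omega> (Suc n) + - smult t (jacobi_poly \<omega> n)) = Suc n"
    by (metis degree_add_eq_left degree_jacobi_poly)
  then show ?thesis by (simp add: quasi_jacobi_poly_def)
qed

lemma card_roots_rsquarefree:
  fixes p :: "complex poly"
  assumes "rsquarefree p"
  shows "card {z. poly p z = 0} = degree p"
proof -
  have p: "p \<noteq> 0" using assms by (auto simp: rsquarefree_def)
  have "degree p = degree (smult (lead_coeff p) (\<Prod>z|poly p z = 0. [:-z, 1:]))"
    using complex_poly_decompose_rsquarefree[OF assms] by simp
  also have "\<dots> = (\<Sum>z|poly p z = 0. degree [:-z, 1:])"
    using p by (simp add: degree_prod_eq_sum_degree)
  finally show ?thesis by simp
qed

text \<open>At a zero \<open>z\<close> of the complex polynomial one has \<open>P\<^sub>n\<^sub>+\<^sub>1 = t P\<^sub>n\<close> with \<open>t\<close> real, and this makes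
the right-hand sides of the Christoffel-Darboux identities vanish: of the first at \<open>(z, cnj z)\<close>, and
of the confluent one if \<open>z\<close> is a double zero. The kernel at \<open>(z, cnj z)\<close> is at least \<open>1\<close>, so \<open>z\<close> is
real and simple, and the fundamental theorem of algebra provides as many zeros as the degree.\<close>

lemma card_roots_quasi_jacobi_poly:
  fixes \<omega> :: "nat \<Rightarrow> real"
  assumes pos: "\<forall>k\<ge>1. \<omega> k > 0"
  shows "card {x. poly (quasi_jacobi_poly \<omega> t n) x = 0} = Suc n"
proof -
  define c where "c = (\<lambda>k. complex_of_real (\<omega> k))"
  define Q where "Q = quasi_jacobi_poly c (of_real t) n"
  let ?P = "\<lambda>k. poly (jacobi_poly c k)"
  have c0: "c k \<noteq> 0" if "k \<ge> 1" for k using pos that by (auto simp: c_def)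
  have norm0: "jacobi_norm c n \<noteq> 0" using c0 by (simp add: jacobi_norm_def)
  have root: "?P (Suc n) z = of_real t * ?P n z" if "poly Q z = 0" for z
    using that by (simp add: Q_def quasi_jacobi_poly_def)
  have cnjP: "?P k (cnj z) = cnj (?P k z)" for k z
    unfolding c_def by (rule poly_jacobi_poly_cnj)
  have realP: "?P k (of_real x) = of_real (poly (jacobi_poly \<omega> k) x)" for k x
    unfolding c_def by (rule poly_jacobi_poly_of_real)
  have kernel: "cd_kernel c n z (cnj z) \<noteq> 0" for z
  proof -
    define s where "s = (\<Sum>k\<le>n. (cmod (?P k z))\<^sup>2 / jacobi_norm \<omega> k)"
    have "cd_kernel c n z (cnj z) = of_real s"
      unfolding cd_kernel_def s_def cnjP
      by (simp add: complex_norm_square jacobi_norm_of_real c_def del: of_real_power)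
    moreover have "s \<ge> (\<Sum>k\<in>{0}. (cmod (?P k z))\<^sup>2 / jacobi_norm \<omega> k)"
      unfolding s_def by (intro sum_mono2) (auto intro!: divide_nonneg_pos jacobi_norm_pos pos)
    ultimately show ?thesis by auto
  qed
  have real: "cnj z = z" if z: "poly Q z = 0" for z
  proof -
    have "(z - cnj z) * cd_kernel c n z (cnj z) * jacobi_norm c n = 0"
      by (subst christoffel_darboux) (simp_all add: c0 cnjP root[OF z])
    then show ?thesis using kernel norm0 by auto
  qed
  have simple: "poly (pderiv Q) z \<noteq> 0" if z: "poly Q z = 0" for z
  proof
    assume "poly (pderiv Q) z = 0"
    then have "poly (pderiv (jacobi_poly c (Suc n))) z = of_real t * poly (pderiv (jacobi_poly c n)) z"
      by (simp add: Q_def quasi_jacobi_poly_def pderiv_diff pderiv_smult)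
    then have "cd_kernel c n z z * jacobi_norm c n = 0"
      by (subst christoffel_darboux_confluent) (simp_all add: c0 root[OF z])
    then show False using kernel[of z] norm0 real[OF z] by auto
  qed
  have "card {z. poly Q z = 0} = degree Q"
    by (rule card_roots_rsquarefree) (use simple rsquarefree_roots in blast)
  moreover have "{z. poly Q z = 0} = of_real ` {x. poly (quasi_jacobi_poly \<omega> t n) x = 0}"
  proof -
    have QR: "poly Q (of_real x) = of_real (poly (quasi_jacobi_poly \<omega> t n) x)" for x
      by (simp add: Q_def quasi_jacobi_poly_def realP del: jacobi_poly.simps)
    show ?thesis
    proof (intro equalityI subsetI)
      fix z assume z: "z \<in> {z. poly Q z = 0}"
      then obtain x where "z = of_real x" using real by (metis Reals_cases Reals_cnj_iff mem_Collect_eq)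
      then show "z \<in> of_real ` {x. poly (quasi_jacobi_poly \<omega> t n) x = 0}"
        using z QR by auto
    qed (auto simp: QR)
  qed
  ultimately show ?thesis
    by (simp add: Q_def degree_quasi_jacobi_poly card_image inj_on_def)
qed

text \<open>By the Christoffel-Darboux identity the kernel vanishes at two distinct nodes, so the
kernel functions \<open>K(x, \<cdot>)\<close> of the nodes \<open>x\<close>, divided by \<open>K(x, x)\<close>, interpolate: the expansion of \<open>P\<^sub>l\<close>
in them agrees with \<open>P\<^sub>l\<close> at \<open>n + 1\<close> points and therefore everywhere. Comparing the coefficients of
\<open>P\<^sub>k\<close> gives the quadrature formula.\<close>

lemma gauss_quadrature:
  fixes \<omega> :: "nat \<Rightarrow> real"
  assumes pos: "\<forall>k\<ge>1. \<omega> k > 0"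
    and X: "X = {x. poly (quasi_jacobi_poly \<omega> t n) x = 0}"
    and kl: "k \<le> n" "l \<le> n"
  shows "(\<Sum>x\<in>X. poly (jacobi_poly \<omega> k) x * poly (jacobi_poly \<omega> l) x / cd_kernel \<omega> n x x)
     = (if k = l then jacobi_norm \<omega> k else 0)"
proof -
  let ?P = "\<lambda>k. poly (jacobi_poly \<omega> k)" and ?K = "cd_kernel \<omega> n" and ?h = "jacobi_norm \<omega>"
  have cardX: "card X = Suc n" unfolding X by (rule card_roots_quasi_jacobi_poly[OF pos])
  have finX: "finite X" using cardX by (metis card.infinite nat.distinct(1))
  have h0: "?h k > 0" for k by (rule jacobi_norm_pos[OF pos])
  have K0: "?K x x \<noteq> 0" for x using cd_kernel_ge_1[OF pos, where n = n and x = x] by auto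
  have orth: "?K x y = 0" if "x \<in> X" "y \<in> X" "x \<noteq> y" for x y
  proof -
    have "(x - y) * ?K x y * ?h n = 0"
      by (subst christoffel_darboux)
         (use that pos in \<open>auto simp: X quasi_jacobi_poly_def less_imp_neq[symmetric] simp del: jacobi_poly.simps\<close>)
    then show ?thesis using h0[of n] that by auto
  qed
  \<comment> \<open>The coefficients of the interpolating expansion of \<open>P\<^sub>l\<close>, regrouped by the \<open>P\<^sub>j\<close>.\<close>
  define a where "a j = (\<Sum>x\<in>X. ?P l x * ?P j x / (?K x x * ?h j))" for j
  define D where "D = (\<Sum>j<Suc n. smult (a j - (if j = l then 1 else 0)) (jacobi_poly \<omega> j))"
  have Deq: "poly D y = (\<Sum>x\<in>X. ?P l x / ?K x x * ?K x y) - ?P l y" for y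
  proof -
    have "poly D y = (\<Sum>j<Suc n. a j * ?P j y) - (\<Sum>j<Suc n. (if j = l then 1 else 0) * ?P j y)"
      by (simp add: D_def poly_sum algebra_simps sum_subtractf del: sum.lessThan_Suc)
    also have "(\<Sum>j<Suc n. (if j = l then 1 else 0) * ?P j y) = ?P l y"
      using kl by (simp add: if_distrib[of "\<lambda>c. c * _"] sum.delta del: sum.lessThan_Suc cong: if_cong)
    also have "(\<Sum>j<Suc n. a j * ?P j y) = (\<Sum>x\<in>X. \<Sum>j<Suc n. ?P l x * ?P j x / (?K x x * ?h j) * ?P j y)"
      unfolding a_def sum_distrib_right by (rule sum.swap)
    also have "\<dots> = (\<Sum>x\<in>X. ?P l x / ?K x x * ?K x y)"
      by (rule sum.cong) (simp_all add: cd_kernel_def[of \<omega> n _ y] lessThan_Suc_atMost sum_distrib_left mult_ac)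
    finally show ?thesis .
  qed
  have Droot: "poly D y = 0" if y: "y \<in> X" for y
  proof -
    have "(\<Sum>x\<in>X. ?P l x / ?K x x * ?K x y) = (\<Sum>x\<in>X. if x = y then ?P l y else 0)"
      by (rule sum.cong) (use orth y K0 in auto)
    then show ?thesis using finX y by (simp add: Deq)
  qed
  have "D = 0"
  proof (rule ccontr)
    assume D: "D \<noteq> 0"
    have "card X \<le> card {y. poly D y = 0}"
      by (rule card_mono) (use D poly_roots_finite Droot in auto)
    also have "\<dots> \<le> degree D" by (rule card_poly_roots_bound[OF D])
    also have "degree D \<le> n" unfolding D_def
      by (rule degree_sum_le) (auto intro: order.trans[OF degree_smult_le])
    finally show False using cardX by simp
  qed
  then have "a k - (if k = l then 1 else 0) = 0"
    unfolding D_def by (rule jacobi_poly_lincomb_eq_0) (use kl in simp)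
  then have "a k = (if k = l then 1 else 0)" by simp
  moreover have "(\<Sum>x\<in>X. ?P k x * ?P l x / ?K x x) = ?h k * a k"
    unfolding a_def sum_distrib_left using h0[of k] by (intro sum.cong) (auto simp: field_simps)
  ultimately show ?thesis by auto
qed

section \<open>Weak limits of measures with convergent moments\<close>

lemma moments_bounded_imp_tight:
  fixes M :: "nat \<Rightarrow> real measure"
  assumes rd: "\<And>n. real_distribution (M n)"
    and int: "\<And>n. integrable (M n) (\<lambda>x. x\<^sup>2)"
    and B: "\<And>n. (\<integral>x. x\<^sup>2 \<partial>M n) \<le> B"
  shows "tight M"
  unfolding tight_def
proof (intro conjI allI impI rd)
  fix \<epsilon> :: real assume \<epsilon>: "\<epsilon> > 0"
  define a where "a = sqrt ((\<bar>B\<bar> + 1) / \<epsilon>)"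
  have a: "a > 0" and a2: "a\<^sup>2 = (\<bar>B\<bar> + 1) / \<epsilon>" using \<epsilon> by (auto simp: a_def)
  have "measure (M n) {-a<..a} > 1 - \<epsilon>" for n
  proof -
    interpret real_distribution "M n" by (rule rd)
    have "measure (M n) (UNIV - {-a<..a}) = (\<integral>x. indicator (UNIV - {-a<..a}) x \<partial>M n)"
      by simp
    also have "\<dots> \<le> (\<integral>x. x\<^sup>2 / a\<^sup>2 \<partial>M n)"
    proof (rule integral_mono)
      fix x :: real
      have "1 \<le> x\<^sup>2 / a\<^sup>2" if "x \<notin> {-a<..a}"
      proof -
        have "a \<le> \<bar>x\<bar>" using that by auto
        then have "a\<^sup>2 \<le> x\<^sup>2" using a by (metis abs_le_square_iff abs_of_pos)
        then show ?thesis using a by simp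
      qed
      then show "indicator (UNIV - {-a<..a}) x \<le> x\<^sup>2 / a\<^sup>2"
        by (auto simp: indicator_def)
    qed (use int in \<open>auto intro!: integrable_real_indicator simp: emeasure_eq_measure\<close>)
    also have "\<dots> \<le> B / a\<^sup>2" using B[of n] by (simp add: divide_right_mono)
    also have "\<dots> < \<epsilon>" using \<epsilon> by (simp add: a2 divide_simps) (simp add: algebra_simps abs_if)
    finally show ?thesis using prob_compl[of "{-a<..a}"] by simp
  qed
  then show "\<exists>a b. a < b \<and> (\<forall>n. 1 - \<epsilon> < measure (M n) {a<..b})"
    using a by (intro exI[of _ "-a"] exI[of _ a]) auto
qed

lemma abs_le_1_plus_square: "\<bar>y\<bar> \<le> 1 + y\<^sup>2" for y :: real
proof -
  have "0 \<le> (\<bar>y\<bar> - 1)\<^sup>2" by simp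
  then have "2 * \<bar>y\<bar> \<le> 1 + y\<^sup>2" by (simp add: power2_diff)
  then show ?thesis using abs_ge_zero[of y] by linarith
qed

text \<open>Damping \<open>y\<close> to \<open>y / (1 + \<epsilon> y\<^sup>2)\<close> gives a bounded continuous function of \<open>y\<close>, to which weak
convergence applies, at an error that is controlled by a fourth moment and is of order \<open>\<epsilon>\<close>
uniformly along a sequence with bounded moments.\<close>

lemma abs_le_damped_bound:
  fixes y \<epsilon> :: real
  assumes "\<epsilon> > 0"
  shows "\<bar>y / (1 + \<epsilon> * y\<^sup>2)\<bar> \<le> 1 + 1 / \<epsilon>"
    and "\<bar>y\<^sup>2 / (1 + \<epsilon> * y\<^sup>2)\<bar> \<le> 1 / \<epsilon>"
    and "\<bar>y - y / (1 + \<epsilon> * y\<^sup>2)\<bar> \<le> \<epsilon> * (1 + y ^ 4)"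
proof -
  have pos: "1 + \<epsilon> * y\<^sup>2 > 0" using assms by (simp add: add_pos_nonneg)
  show sq: "\<bar>y\<^sup>2 / (1 + \<epsilon> * y\<^sup>2)\<bar> \<le> 1 / \<epsilon>"
    using pos assms by (simp add: field_simps)
  have "\<bar>y\<bar> \<le> 1 + y\<^sup>2" by (rule abs_le_1_plus_square)
  then have "\<bar>y / (1 + \<epsilon> * y\<^sup>2)\<bar> \<le> (1 + y\<^sup>2) / (1 + \<epsilon> * y\<^sup>2)"
    using pos by (simp add: divide_right_mono)
  also have "\<dots> = 1 / (1 + \<epsilon> * y\<^sup>2) + y\<^sup>2 / (1 + \<epsilon> * y\<^sup>2)" by (simp add: add_divide_distrib)
  also have "\<dots> \<le> 1 + 1 / \<epsilon>"
    using sq assms pos by (intro add_mono) (auto simp: divide_le_eq)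
  finally show "\<bar>y / (1 + \<epsilon> * y\<^sup>2)\<bar> \<le> 1 + 1 / \<epsilon>" .
  have "\<bar>y - y / (1 + \<epsilon> * y\<^sup>2)\<bar> = \<epsilon> * \<bar>y\<bar> ^ 3 / (1 + \<epsilon> * y\<^sup>2)"
  proof -
    have "y - y / (1 + \<epsilon> * y\<^sup>2) = \<epsilon> * y ^ 3 / (1 + \<epsilon> * y\<^sup>2)"
      using pos by (simp add: field_simps power2_eq_square power3_eq_cube)
    then show ?thesis using pos assms by (simp add: abs_mult power_abs)
  qed
  also have "\<dots> \<le> \<epsilon> * \<bar>y\<bar> ^ 3 / 1"
    using assms pos by (intro divide_left_mono) auto
  also have "\<bar>y\<bar> ^ 3 \<le> 1 + y ^ 4"
  proof (cases "\<bar>y\<bar> \<le> 1")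
    case True
    then have "\<bar>y\<bar> ^ 3 \<le> 1" by (simp add: power_le_one)
    then show ?thesis by (smt (verit) zero_le_even_power even_numeral)
  next
    case False
    then have "\<bar>y\<bar> ^ 3 \<le> \<bar>y\<bar> ^ 4" by (intro power_increasing) auto
    then show ?thesis by (simp add: power_even_abs)
  qed
  finally show "\<bar>y - y / (1 + \<epsilon> * y\<^sup>2)\<bar> \<le> \<epsilon> * (1 + y ^ 4)" using assms by simp
qed

lemma continuous_damped_power:
  fixes \<epsilon> x :: real
  assumes "\<epsilon> > 0"
  shows "isCont (\<lambda>x. x ^ k / (1 + \<epsilon> * (x ^ k)\<^sup>2)) x"
    and "isCont (\<lambda>x. (x ^ k)\<^sup>2 / (1 + \<epsilon> * (x ^ k)\<^sup>2)) x"
proof -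
  have "1 + \<epsilon> * (x ^ k)\<^sup>2 \<noteq> 0" using assms
    by (metis add_pos_nonneg less_le mult_nonneg_nonneg order_less_irrefl zero_le_power2 zero_less_one)
  then show "isCont (\<lambda>x. x ^ k / (1 + \<epsilon> * (x ^ k)\<^sup>2)) x"
    and "isCont (\<lambda>x. (x ^ k)\<^sup>2 / (1 + \<epsilon> * (x ^ k)\<^sup>2)) x"
    by (auto intro!: continuous_intros)
qed

text \<open>Fatou's lemma, as the damping of \<open>(x\<^sup>k)\<^sup>2\<close> tends to zero.\<close>

lemma weak_limit_even_moment_integrable:
  fixes M :: "nat \<Rightarrow> real measure"
  assumes rd: "\<And>n. real_distribution (M n)" and rd\<nu>: "real_distribution \<nu>"
    and conv: "weak_conv_m M \<nu>"
    and int: "\<And>n. integrable (M n) (\<lambda>x. (x ^ k)\<^sup>2)"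
    and B: "\<And>n. (\<integral>x. (x ^ k)\<^sup>2 \<partial>M n) \<le> B"
  shows "integrable \<nu> (\<lambda>x. (x ^ k)\<^sup>2)"
proof (rule integrableI_bounded)
  interpret N: real_distribution \<nu> by (rule rd\<nu>)
  define f where "f j x = (x ^ k)\<^sup>2 / (1 + inverse (real (Suc j)) * (x ^ k)\<^sup>2)" for j x
  have f0: "f j x \<ge> 0" for j x by (simp add: f_def)
  have fle: "f j x \<le> (x ^ k)\<^sup>2" for j x
    by (simp add: f_def divide_le_eq add_pos_nonneg mult_le_cancel_left1)
  have fB: "norm (f j x) \<le> real (Suc j)" for j x
    using abs_le_damped_bound(2)[of "inverse (real (Suc j))" "x ^ k"] by (simp add: f_def divide_inverse)
  have fC: "isCont (f j) x" for j x
    unfolding f_def[abs_def] by (rule continuous_damped_power) simp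
  have fm [measurable]: "f j \<in> borel_measurable borel" for j
    by (simp add: borel_measurable_continuous_onI continuous_at_imp_continuous_on fC)
  have intf: "integrable \<nu> (f j)" for j
    using fB by (intro N.integrable_const_bound[where B = "real (Suc j)"]) auto
  have le: "(\<integral>x. f j x \<partial>\<nu>) \<le> B" for j
  proof (rule LIMSEQ_le_const2)
    show "(\<lambda>n. \<integral>x. f j x \<partial>M n) \<longlonglongrightarrow> (\<integral>x. f j x \<partial>\<nu>)"
      by (rule weak_conv_imp_integral_bdd_continuous_conv[OF rd rd\<nu> conv fC fB])
    show "\<exists>N. \<forall>n\<ge>N. (\<integral>x. f j x \<partial>M n) \<le> B"
    proof (intro exI allI impI)
      fix n
      interpret real_distribution "M n" by (rule rd)
      have "(\<integral>x. f j x \<partial>M n) \<le> (\<integral>x. (x ^ k)\<^sup>2 \<partial>M n)"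
      proof (rule integral_mono)
        show "integrable (M n) (f j)"
          using fB by (intro integrable_const_bound[where B = "real (Suc j)"]) auto
      qed (use fle int in auto)
      then show "(\<integral>x. f j x \<partial>M n) \<le> B" using B[of n] by simp
    qed
  qed
  have lim: "(\<lambda>j. ennreal (f j x)) \<longlonglongrightarrow> ennreal ((x ^ k)\<^sup>2)" for x
  proof -
    have "(\<lambda>j. f j x) \<longlonglongrightarrow> (x ^ k)\<^sup>2 / (1 + 0 * (x ^ k)\<^sup>2)"
      unfolding f_def by (intro tendsto_intros LIMSEQ_inverse_real_of_nat) simp
    then show ?thesis by (intro tendsto_ennrealI) simp
  qed
  have "(\<integral>\<^sup>+x. ennreal (norm ((x ^ k)\<^sup>2)) \<partial>\<nu>) = (\<integral>\<^sup>+x. liminf (\<lambda>j. ennreal (f j x)) \<partial>\<nu>)"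
    using lim_imp_Liminf[OF sequentially_bot lim] by simp
  also have "\<dots> \<le> liminf (\<lambda>j. \<integral>\<^sup>+x. ennreal (f j x) \<partial>\<nu>)"
    by (rule nn_integral_liminf) simp
  also have "\<dots> = liminf (\<lambda>j. ennreal (\<integral>x. f j x \<partial>\<nu>))"
    using intf f0 by (subst nn_integral_eq_integral) auto
  also have "\<dots> \<le> ennreal B"
    by (rule Liminf_le) (auto intro!: always_eventually ennreal_leI le)
  finally show "(\<integral>\<^sup>+x. ennreal (norm ((x ^ k)\<^sup>2)) \<partial>\<nu>) < \<infinity>"
    by (simp add: order.strict_trans1)
  show "(\<lambda>x. (x ^ k)\<^sup>2) \<in> borel_measurable \<nu>" by simp
qed

lemma integrable_power_of_square:
  assumes "real_distribution \<nu>" and int: "integrable \<nu> (\<lambda>x. (x ^ k)\<^sup>2)"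
  shows "integrable \<nu> (\<lambda>x. x ^ k)"
proof -
  interpret real_distribution \<nu> by fact
  have "integrable \<nu> (\<lambda>x. 1 + (x ^ k)\<^sup>2)" using int by simp
  moreover have "\<bar>y\<bar> \<le> \<bar>1 + y\<^sup>2\<bar>" for y :: real
    using abs_le_1_plus_square[of y] by linarith
  ultimately show ?thesis by (intro Bochner_Integration.integrable_bound[of \<nu> "\<lambda>x. 1 + (x ^ k)\<^sup>2" "\<lambda>x. x ^ k"]) auto
qed

lemma damped_power_integral_error:
  assumes "real_distribution M" and \<epsilon>: "\<epsilon> > 0" and int: "\<And>k. integrable M (\<lambda>x. x ^ k)"
  shows "\<bar>(\<integral>x. x ^ k \<partial>M) - (\<integral>x. x ^ k / (1 + \<epsilon> * (x ^ k)\<^sup>2) \<partial>M)\<bar>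
           \<le> \<epsilon> * (1 + (\<integral>x. x ^ (k * 4) \<partial>M))"
proof -
  interpret real_distribution M by fact
  let ?g = "\<lambda>x::real. x ^ k / (1 + \<epsilon> * (x ^ k)\<^sup>2)"
  have g: "integrable M ?g"
    using abs_le_damped_bound(1)[OF \<epsilon>]
    by (intro integrable_const_bound[where B = "1 + 1 / \<epsilon>"]) auto
  have "\<bar>(\<integral>x. x ^ k \<partial>M) - (\<integral>x. ?g x \<partial>M)\<bar> = \<bar>\<integral>x. x ^ k - ?g x \<partial>M\<bar>"
    using g int by simp
  also have "\<dots> \<le> (\<integral>x. \<bar>x ^ k - ?g x\<bar> \<partial>M)" by (rule integral_abs_bound)
  also have "\<dots> \<le> (\<integral>x. \<epsilon> * (1 + x ^ (k * 4)) \<partial>M)"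
  proof (rule integral_mono)
    show "\<bar>x ^ k - ?g x\<bar> \<le> \<epsilon> * (1 + x ^ (k * 4))" for x
      using abs_le_damped_bound(3)[OF \<epsilon>, of "x ^ k"] by (simp add: power_mult)
  qed (use g int in auto)
  also have "\<dots> = \<epsilon> * (1 + (\<integral>x. x ^ (k * 4) \<partial>M))" using int prob_space by simp
  finally show ?thesis .
qed

text \<open>Bounded second moments give tightness, hence a weakly convergent subsequence. Each moment passes
to the limit because a higher moment is bounded.\<close>

lemma weak_limit_of_convergent_moments:
  fixes M :: "nat \<Rightarrow> real measure"
  assumes rd: "\<And>n. real_distribution (M n)"
    and int: "\<And>n k. integrable (M n) (\<lambda>x. x ^ k)"
    and lim: "\<And>k. (\<lambda>n. \<integral>x. x ^ k \<partial>M n) \<longlonglongrightarrow> m k"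
  obtains s \<nu> where "strict_mono s" "real_distribution \<nu>" "weak_conv_m (M \<circ> s) \<nu>"
    "\<And>k. integrable \<nu> (\<lambda>x. x ^ k)" "\<And>k. (\<integral>x. x ^ k \<partial>\<nu>) = m k"
proof -
  have bdd: "\<exists>B. \<forall>n. (\<integral>x. x ^ k \<partial>M n) \<le> B" for k
    using convergent_imp_Bseq[OF convergentI[OF lim[of k]]] unfolding Bseq_def
    by (metis abs_le_D1 real_norm_def)
  obtain B2 where "\<And>n. (\<integral>x. x\<^sup>2 \<partial>M n) \<le> B2" using bdd[of 2] by blast
  then have "tight M" by (intro moments_bounded_imp_tight rd int)
  then obtain s \<nu> where s: "strict_mono s" and rd\<nu>: "real_distribution \<nu>"
    and conv: "weak_conv_m (M \<circ> s) \<nu>"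
    using tight_imp_convergent_subsubsequence[of M id] by (auto simp: strict_mono_def)
  have rds: "\<And>n. real_distribution ((M \<circ> s) n)" by (simp add: rd)
  have int\<nu>: "integrable \<nu> (\<lambda>x. x ^ k)" for k
  proof (rule integrable_power_of_square[OF rd\<nu>])
    obtain B where "\<And>n. (\<integral>x. x ^ (k * 2) \<partial>M n) \<le> B" using bdd by blast
    then show "integrable \<nu> (\<lambda>x. (x ^ k)\<^sup>2)"
      by (intro weak_limit_even_moment_integrable[OF rds rd\<nu> conv])
         (auto simp: power_mult[symmetric] int)
  qed
  have eq: "(\<integral>x. x ^ k \<partial>\<nu>) = m k" for k
  proof -
    \<comment> \<open>Two damping errors, one along the sequence and one for the limit.\<close>
    define C where "C = 2 + m (k * 4) + (\<integral>x. x ^ (k * 4) \<partial>\<nu>)"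
    have le: "\<bar>(\<integral>x. x ^ k \<partial>\<nu>) - m k\<bar> \<le> \<epsilon> * C" if \<epsilon>: "\<epsilon> > 0" for \<epsilon>
    proof -
      let ?g = "\<lambda>x::real. x ^ k / (1 + \<epsilon> * (x ^ k)\<^sup>2)"
      have lims: "(\<lambda>n. \<integral>x. x ^ j \<partial>M (s n)) \<longlonglongrightarrow> m j" for j
        using LIMSEQ_subseq_LIMSEQ[OF lim s] by (simp add: o_def)
      have "(\<lambda>n. \<integral>x. ?g x \<partial>(M \<circ> s) n) \<longlonglongrightarrow> (\<integral>x. ?g x \<partial>\<nu>)"
        by (rule weak_conv_imp_integral_bdd_continuous_conv[OF rds rd\<nu> conv])
           (use continuous_damped_power(1)[OF \<epsilon>] abs_le_damped_bound(1)[OF \<epsilon>] in auto)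
      then have "(\<lambda>n. \<bar>(\<integral>x. x ^ k \<partial>M (s n)) - (\<integral>x. ?g x \<partial>M (s n))\<bar>)
                   \<longlonglongrightarrow> \<bar>m k - (\<integral>x. ?g x \<partial>\<nu>)\<bar>"
        by (intro tendsto_intros lims) (simp add: o_def)
      moreover have "(\<lambda>n. \<epsilon> * (1 + (\<integral>x. x ^ (k * 4) \<partial>M (s n)))) \<longlonglongrightarrow> \<epsilon> * (1 + m (k * 4))"
        by (intro tendsto_intros lims)
      ultimately have "\<bar>m k - (\<integral>x. ?g x \<partial>\<nu>)\<bar> \<le> \<epsilon> * (1 + m (k * 4))"
        by (rule LIMSEQ_le) (use damped_power_integral_error[OF rd \<epsilon> int] in blast)
      moreover have "\<bar>(\<integral>x. x ^ k \<partial>\<nu>) - (\<integral>x. ?g x \<partial>\<nu>)\<bar> \<le> \<epsilon> * (1 + (\<integral>x. x ^ (k * 4) \<partial>\<nu>))"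
        by (rule damped_power_integral_error[OF rd\<nu> \<epsilon> int\<nu>])
      ultimately show ?thesis by (simp add: C_def algebra_simps abs_le_iff)
    qed
    have "(\<lambda>n. inverse (real (Suc n)) * C) \<longlonglongrightarrow> 0 * C"
      by (intro tendsto_intros LIMSEQ_inverse_real_of_nat)
    then have "\<bar>(\<integral>x. x ^ k \<partial>\<nu>) - m k\<bar> \<le> 0 * C"
      by (rule LIMSEQ_le_const) (use le in auto)
    then show ?thesis by simp
  qed
  show thesis by (rule that[OF s rd\<nu> conv int\<nu> eq])
qed

text \<open>Weak convergence does not lose mass at a point: hat functions of height \<open>1\<close> around \<open>x0\<close> dominate
the indicator of \<open>{x0}\<close> and shrink to it.\<close>

lemma weak_limit_atom:
  fixes M :: "nat \<Rightarrow> real measure"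
  assumes rd: "\<And>n. real_distribution (M n)" and rd\<nu>: "real_distribution \<nu>"
    and conv: "weak_conv_m M \<nu>" and atom: "\<And>n. c \<le> measure (M n) {x0}"
  shows "c \<le> measure \<nu> {x0}"
proof -
  interpret N: real_distribution \<nu> by (rule rd\<nu>)
  define f where "f j x = max 0 (1 - real j * \<bar>x - x0\<bar>)" for j x
  have f01: "0 \<le> f j x" "f j x \<le> 1" for j x by (auto simp: f_def)
  have fB: "norm (f j x) \<le> 1" for j x using f01[of j x] by simp
  have fC: "isCont (f j) x" for j x
    unfolding f_def by (intro continuous_intros)
  have fm [measurable]: "f j \<in> borel_measurable borel" for j
    by (simp add: borel_measurable_continuous_onI continuous_at_imp_continuous_on fC)
  have ge: "c \<le> (\<integral>x. f j x \<partial>\<nu>)" for j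
  proof (rule LIMSEQ_le_const)
    show "(\<lambda>n. \<integral>x. f j x \<partial>M n) \<longlonglongrightarrow> (\<integral>x. f j x \<partial>\<nu>)"
      by (rule weak_conv_imp_integral_bdd_continuous_conv[OF rd rd\<nu> conv fC fB])
    show "\<exists>N. \<forall>n\<ge>N. c \<le> (\<integral>x. f j x \<partial>M n)"
    proof (intro exI allI impI)
      fix n
      interpret real_distribution "M n" by (rule rd)
      have "c \<le> (\<integral>x. indicator {x0} x \<partial>M n)" using atom by simp
      also have "\<dots> \<le> (\<integral>x. f j x \<partial>M n)"
        using fB by (intro integral_mono integrable_const_bound[where B = 1] integrable_real_indicator)
          (auto simp: indicator_def f01 emeasure_eq_measure, simp add: f_def)
      finally show "c \<le> (\<integral>x. f j x \<partial>M n)" .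
    qed
  qed
  have "(\<lambda>j. \<integral>x. f j x \<partial>\<nu>) \<longlonglongrightarrow> (\<integral>x. indicator {x0} x \<partial>\<nu>)"
  proof (rule integral_dominated_convergence[where w = "\<lambda>_. 1"])
    show "AE x in \<nu>. (\<lambda>j. f j x) \<longlonglongrightarrow> indicator {x0} x"
    proof (rule AE_I2)
      fix x
      show "(\<lambda>j. f j x) \<longlonglongrightarrow> indicator {x0} x"
      proof (cases "x = x0")
        case True then show ?thesis by (simp add: f_def)
      next
        case False
        then obtain N where N: "1 < real N * \<bar>x - x0\<bar>"
          using reals_Archimedean3[of "\<bar>x - x0\<bar>"] by auto
        have "f j x = 0" if "j \<ge> N" for j
        proof -
          have "real N * \<bar>x - x0\<bar> \<le> real j * \<bar>x - x0\<bar>" using that by (intro mult_right_mono) auto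
          then show ?thesis using N by (simp add: f_def)
        qed
        then have "\<forall>\<^sub>F j in sequentially. f j x = indicator {x0} x"
          using False by (auto simp: eventually_sequentially)
        then show ?thesis by (rule tendsto_eventually)
      qed
    qed
  qed (use fB in auto)
  then have "(\<lambda>j. \<integral>x. f j x \<partial>\<nu>) \<longlonglongrightarrow> measure \<nu> {x0}" by simp
  then show ?thesis by (rule LIMSEQ_le_const) (use ge in auto)
qed

section \<open>Moments in terms of the Jacobi sequence\<close>

text \<open>The coefficients of \<open>x\<^sup>n\<close> in the basis of the \<open>P\<^sub>k\<close>; they count weighted Motzkin paths without level
steps. The coefficient of \<open>P\<^sub>0\<close> is the \<open>n\<close>-th moment, so the Jacobi sequence determines all moments.\<close>

fun jacobi_expansion :: "(nat \<Rightarrow> 'a::comm_ring_1) \<Rightarrow> nat \<Rightarrow> nat \<Rightarrow> 'a" where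
  "jacobi_expansion \<omega> 0 k = (if k = 0 then 1 else 0)"
| "jacobi_expansion \<omega> (Suc n) k =
     (if k = 0 then 0 else jacobi_expansion \<omega> n (k - 1)) + \<omega> (Suc k) * jacobi_expansion \<omega> n (Suc k)"

lemma jacobi_expansion_eq_0: "n < k \<Longrightarrow> jacobi_expansion \<omega> n k = 0"
  by (induction n arbitrary: k) auto

lemma monomial_eq_jacobi_expansion:
  "[:0, 1:] ^ n = (\<Sum>k\<le>n. smult (jacobi_expansion \<omega> n k) (jacobi_poly \<omega> k))"
proof (induction n)
  case (Suc n)
  let ?c = "jacobi_expansion \<omega> n" and ?P = "jacobi_poly \<omega>"
  have "[:0, 1:] ^ Suc n = (\<Sum>k\<le>n. smult (?c k) ([:0, 1:] * ?P k))"
    unfolding power_Suc Suc.IH sum_distrib_left by (simp add: mult_smult_right del: mult_pCons_left)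
  also have "\<dots> = (\<Sum>k\<le>n. smult (?c k) (?P (Suc k)))
       + (\<Sum>k\<le>n. if k = 0 then 0 else smult (\<omega> k * ?c k) (?P (k - 1)))"
    unfolding jacobi_poly_three_term sum.distrib[symmetric]
    by (intro sum.cong) (auto simp: smult_add_right mult.commute)
  also have "(\<Sum>k\<le>n. smult (?c k) (?P (Suc k)))
       = (\<Sum>k\<le>Suc n. smult (if k = 0 then 0 else ?c (k - 1)) (?P k))"
    by (subst sum.atMost_Suc_shift) simp
  \<comment> \<open>The added terms have index above \<open>n\<close> and vanish; they make the shifted ranges of summation agree.\<close>
  also have "(\<Sum>k\<le>n. if k = 0 then 0 else smult (\<omega> k * ?c k) (?P (k - 1)))
       = (\<Sum>k\<le>Suc (Suc n). if k = 0 then 0 else smult (\<omega> k * ?c k) (?P (k - 1)))"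
    by (simp add: jacobi_expansion_eq_0)
  also have "\<dots> = (\<Sum>k\<le>Suc n. smult (\<omega> (Suc k) * ?c (Suc k)) (?P k))"
    by (subst sum.atMost_Suc_shift) simp
  finally show ?case by (simp add: sum.distrib[symmetric] smult_add_left[symmetric] del: sum.atMost_Suc)
qed simp

lemma integrable_poly:
  assumes "\<And>k. integrable \<mu> (\<lambda>x. x ^ k)"
  shows "integrable \<mu> (\<lambda>x. poly f x :: real)"
  unfolding poly_altdef using assms by auto

lemma integral_poly:
  assumes "\<And>k. integrable \<mu> (\<lambda>x. x ^ k)"
  shows "(\<integral>x. poly f x \<partial>\<mu>) = (\<Sum>k\<le>degree f. coeff f k * (\<integral>x. x ^ k \<partial>\<mu>) :: real)"
  unfolding poly_altdef using assms by (subst Bochner_Integration.integral_sum) auto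

lemma moment_eq_jacobi_expansion:
  fixes \<mu> :: "real measure"
  assumes "prob_space \<mu>" and int: "\<And>k. integrable \<mu> (\<lambda>x. x ^ k)"
    and orth: "\<And>k. 0 < k \<Longrightarrow> k \<le> n \<Longrightarrow> (\<integral>x. poly (jacobi_poly \<omega> k) x \<partial>\<mu>) = 0"
  shows "(\<integral>x. x ^ n \<partial>\<mu>) = jacobi_expansion \<omega> n 0"
proof -
  interpret prob_space \<mu> by fact
  let ?c = "jacobi_expansion \<omega> n"
  have "x ^ n = (\<Sum>k\<le>n. ?c k * poly (jacobi_poly \<omega> k) x)" for x
  proof -
    have "x ^ n = poly ([:0, 1:] ^ n) x" by (simp add: poly_power)
    also have "\<dots> = (\<Sum>k\<le>n. ?c k * poly (jacobi_poly \<omega> k) x)"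
      by (subst monomial_eq_jacobi_expansion[of n \<omega>]) (simp add: poly_sum)
    finally show ?thesis .
  qed
  then have "(\<integral>x. x ^ n \<partial>\<mu>) = (\<Sum>k\<le>n. ?c k * (\<integral>x. poly (jacobi_poly \<omega> k) x \<partial>\<mu>))"
    using integrable_poly[OF int] by (simp add: Bochner_Integration.integral_sum)
  also have "\<dots> = (\<Sum>k\<le>n. if k = 0 then ?c 0 else 0)"
    using orth prob_space by (intro sum.cong) auto
  finally show ?thesis by simp
qed

lemma corresponds_to_jacobi_moments:
  assumes "corresponds_to_jacobi \<mu> \<omega>"
  shows "(\<integral>x. x ^ n \<partial>\<mu>) = jacobi_expansion \<omega> n 0"
proof -
  from assms interpret real_distribution \<mu> by (simp add: corresponds_to_jacobi_def)
  from assms obtain P where P: "monic_orthogonal_polys \<mu> P"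
    and rec: "\<And>n. [:0, 1:] * P n = P (Suc n) + (if n = 0 then 0 else smult (\<omega> n) (P (n - 1)))"
    unfolding corresponds_to_jacobi_def by blast
  have "degree (P 0) = 0 \<and> lead_coeff (P 0) = 1"
    using P unfolding monic_orthogonal_polys_def by blast
  then have P0: "P 0 = 1" by (metis degree_eq_zeroE lead_coeff_pCons(2) one_pCons)
  have P_eq: "P n = jacobi_poly \<omega> n" for n by (rule jacobi_poly_unique[OF P0 rec])
  show ?thesis
  proof (rule moment_eq_jacobi_expansion)
    show "prob_space \<mu>" by (rule prob_space_axioms)
    show "integrable \<mu> (\<lambda>x. x ^ k)" for k using assms by (simp add: corresponds_to_jacobi_def)
    fix k :: nat assume "0 < k"
    then have "(\<integral>x. poly (P k) x * poly (P 0) x \<partial>\<mu>) = 0"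
      using P by (simp add: monic_orthogonal_polys_def)
    then show "(\<integral>x. poly (jacobi_poly \<omega> k) x \<partial>\<mu>) = 0" by (simp add: P_eq)
  qed
qed

section \<open>Existence of a measure with a given Jacobi sequence\<close>

lemma AE_in_measure_support:
  assumes "real_distribution \<mu>"
  shows "AE x in \<mu>. x \<in> measure_support \<mu>"
proof -
  interpret real_distribution \<mu> by fact
  define F where "F = {U. open U \<and> emeasure \<mu> U = 0}"
  have "\<And>U. U \<in> F \<Longrightarrow> open U" by (simp add: F_def)
  from Lindelof[OF this] obtain G where G: "G \<subseteq> F" "countable G" "\<Union>G = \<Union>F" by blast
  have "\<Union>F = - measure_support \<mu>"
    by (auto simp: F_def measure_support_def zero_less_iff_neq_zero)
  moreover have "(\<Union>U\<in>G. U) \<in> null_sets \<mu>"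
    using G by (intro null_sets_UN') (auto simp: F_def null_sets_def)
  ultimately have "- measure_support \<mu> \<in> null_sets \<mu>" using G by simp
  then show ?thesis by (rule AE_I') auto
qed

text \<open>If the support were finite with \<open>d\<close> points, the monic polynomial \<open>q\<close> of degree \<open>d\<close> with these zeros
would vanish almost everywhere, whereas \<open>\<integral> q P\<^sub>d = \<integral> P\<^sub>d\<^sup>2 > 0\<close>.\<close>

lemma infinite_measure_support:
  assumes "real_distribution \<mu>" and int: "\<And>k. integrable \<mu> (\<lambda>x. x ^ k)"
    and pos: "\<forall>k\<ge>1. \<omega> k > 0"
    and orth: "\<And>k l. (\<integral>x. poly (jacobi_poly \<omega> k) x * poly (jacobi_poly \<omega> l) x \<partial>\<mu>)
                 = (if k = l then jacobi_norm \<omega> k else 0)"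
  shows "infinite (measure_support \<mu>)"
proof
  interpret real_distribution \<mu> by fact
  assume fin: "finite (measure_support \<mu>)"
  define d where "d = card (measure_support \<mu>)"
  define q where "q = (\<Prod>a\<in>measure_support \<mu>. [:-a, 1:])"
  have deg: "degree q = d" by (simp add: q_def d_def degree_prod_eq_sum_degree)
  have "lead_coeff q = 1" by (simp add: q_def lead_coeff_prod)
  then have lead: "coeff q d = 1" by (simp add: deg)
  obtain a where a: "q = (\<Sum>k<Suc d. smult (a k) (jacobi_poly \<omega> k))"
    using jacobi_poly_span[of q "Suc d" \<omega>] deg by auto
  have "coeff (\<Sum>k<d. smult (a k) (jacobi_poly \<omega> k)) d = 0"
    by (simp add: coeff_sum coeff_eq_0)
  then have ad: "a d = 1" using lead unfolding a by simp
  have "(\<integral>x. poly q x * poly (jacobi_poly \<omega> d) x \<partial>\<mu>)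
      = (\<integral>x. (\<Sum>k<Suc d. a k * (poly (jacobi_poly \<omega> k) x * poly (jacobi_poly \<omega> d) x)) \<partial>\<mu>)"
    unfolding a poly_sum sum_distrib_right by (simp add: mult.assoc del: sum.lessThan_Suc)
  also have "\<dots> = (\<Sum>k<Suc d. a k * (if k = d then jacobi_norm \<omega> k else 0))"
    by (subst Bochner_Integration.integral_sum)
       (use integrable_poly[OF int, of "_ * _"] orth in \<open>auto simp: poly_mult[symmetric] simp del: poly_mult\<close>)
  also have "\<dots> = jacobi_norm \<omega> d" using ad by simp
  finally have "(\<integral>x. poly q x * poly (jacobi_poly \<omega> d) x \<partial>\<mu>) > 0"
    using jacobi_norm_pos[OF pos] by simp
  moreover have "AE x in \<mu>. poly q x * poly (jacobi_poly \<omega> d) x = 0"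
    using AE_in_measure_support[OF \<open>real_distribution \<mu>\<close>]
    by eventually_elim (use fin in \<open>auto simp: q_def poly_prod\<close>)
  then have "(\<integral>x. poly q x * poly (jacobi_poly \<omega> d) x \<partial>\<mu>) = 0"
    by (rule integral_eq_zero_AE)
  ultimately show False by simp
qed

text \<open>The quadrature formula read as a discrete measure. The choice \<open>t = P\<^sub>n\<^sub>+\<^sub>1(x0) / P\<^sub>n(x0)\<close> makes \<open>x0\<close> a
node, with the weight \<open>1 / K\<^sub>n(x0, x0)\<close>.\<close>

lemma gauss_measure:
  fixes \<omega> :: "nat \<Rightarrow> real"
  assumes pos: "\<forall>k\<ge>1. \<omega> k > 0" and x0: "poly (jacobi_poly \<omega> n) x0 \<noteq> 0"
  obtains \<nu> where "real_distribution \<nu>" "\<And>k. integrable \<nu> (\<lambda>x. x ^ k)"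
    "\<And>k l. k \<le> n \<Longrightarrow> l \<le> n \<Longrightarrow>
       (\<integral>x. poly (jacobi_poly \<omega> k) x * poly (jacobi_poly \<omega> l) x \<partial>\<nu>)
         = (if k = l then jacobi_norm \<omega> k else 0)"
    "measure \<nu> {x0} = 1 / cd_kernel \<omega> n x0 x0"
proof -
  define t where "t = poly (jacobi_poly \<omega> (Suc n)) x0 / poly (jacobi_poly \<omega> n) x0"
  define X where "X = {x. poly (quasi_jacobi_poly \<omega> t n) x = 0}"
  define w where "w x = (if x \<in> X then 1 / cd_kernel \<omega> n x x else 0)" for x
  have K: "cd_kernel \<omega> n x x > 0" for x
    using cd_kernel_ge_1[OF pos, of n x] by linarith
  have x0X: "x0 \<in> X" using x0 by (simp add: X_def quasi_jacobi_poly_def t_def)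
  have "card X = Suc n" unfolding X_def by (rule card_roots_quasi_jacobi_poly[OF pos])
  then have finX: "finite X" by (metis card.infinite nat.distinct(1))
  have w0: "w x \<ge> 0" for x using K[of x] by (simp add: w_def)
  have sum1: "(\<Sum>x\<in>X. w x) = 1"
    using gauss_quadrature[OF pos X_def, of 0 0] by (simp add: w_def)
  have "(\<integral>\<^sup>+x. ennreal (w x) \<partial>count_space UNIV) = (\<Sum>x\<in>X. ennreal (w x))"
    using finX by (intro nn_integral_count_space') (auto simp: w_def)
  also have "\<dots> = 1" using sum1 by (simp add: sum_ennreal w0)
  finally have nn: "(\<integral>\<^sup>+x. ennreal (w x) \<partial>count_space UNIV) = 1" .
  define \<pi> where "\<pi> = embed_pmf w"
  have pmf: "pmf \<pi> x = w x" for x unfolding \<pi>_def by (rule pmf_embed_pmf[OF w0 nn])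
  have set\<pi>: "set_pmf \<pi> \<subseteq> X" by (auto simp: set_pmf_iff pmf w_def split: if_splits)
  define \<nu> where "\<nu> = distr (measure_pmf \<pi>) borel (\<lambda>x. x)"
  have integral: "(\<integral>x. f x \<partial>\<nu>) = (\<Sum>x\<in>X. f x / cd_kernel \<omega> n x x)"
    if "f \<in> borel_measurable borel" for f :: "real \<Rightarrow> real"
  proof -
    have "(\<integral>x. f x \<partial>\<nu>) = (\<integral>x. f x \<partial>measure_pmf \<pi>)"
      unfolding \<nu>_def by (rule integral_distr) (use that in simp_all)
    also have "\<dots> = (\<Sum>x\<in>X. f x * pmf \<pi> x)"
      by (rule integral_measure_pmf_real[OF finX]) (use set\<pi> in auto)
    finally show ?thesis by (simp add: pmf w_def)
  qed
  show thesis
  proof (rule that)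
    show "real_distribution \<nu>"
      unfolding \<nu>_def by (rule prob_space.real_distribution_distr[OF prob_space_measure_pmf]) simp
    show "integrable \<nu> (\<lambda>x. x ^ k)" for k
      unfolding \<nu>_def
      by (subst integrable_distr_eq)
         (auto intro!: integrable_measure_pmf_finite finite_subset[OF set\<pi> finX])
    show "(\<integral>x. poly (jacobi_poly \<omega> k) x * poly (jacobi_poly \<omega> l) x \<partial>\<nu>)
        = (if k = l then jacobi_norm \<omega> k else 0)" if "k \<le> n" "l \<le> n" for k l
      using gauss_quadrature[OF pos X_def that]
      by (subst integral) (auto intro!: borel_measurable_continuous_onI continuous_intros)
    have "measure \<nu> {x0} = measure (measure_pmf \<pi>) {x0}"
      unfolding \<nu>_def by (subst measure_distr) auto
    also have "\<dots> = w x0" by (simp add: measure_pmf_single pmf)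
    finally show "measure \<nu> {x0} = 1 / cd_kernel \<omega> n x0 x0" using x0X by (simp add: w_def)
  qed
qed

text \<open>Every moment is eventually constant along such a sequence, so integrals of polynomials against a
weak limit agree with those against a late member of the sequence.\<close>

lemma corresponds_to_jacobi_limit:
  fixes M :: "nat \<Rightarrow> real measure"
  assumes pos: "\<forall>k\<ge>1. \<omega> k > 0"
    and rd: "\<And>n. real_distribution (M n)" and int: "\<And>n k. integrable (M n) (\<lambda>x. x ^ k)"
    and orth: "\<And>n k l. k \<le> n \<Longrightarrow> l \<le> n \<Longrightarrow>
       (\<integral>x. poly (jacobi_poly \<omega> k) x * poly (jacobi_poly \<omega> l) x \<partial>M n)
         = (if k = l then jacobi_norm \<omega> k else 0)"
  obtains s \<nu> where "strict_mono s" "weak_conv_m (M \<circ> s) \<nu>" "corresponds_to_jacobi \<nu> \<omega>"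
proof -
  have moment: "(\<integral>x. x ^ k \<partial>M n) = jacobi_expansion \<omega> k 0" if "k \<le> n" for n k
  proof (rule moment_eq_jacobi_expansion)
    interpret real_distribution "M n" by (rule rd)
    show "prob_space (M n)" by (rule prob_space_axioms)
    show "(\<integral>x. poly (jacobi_poly \<omega> j) x \<partial>M n) = 0" if "0 < j" "j \<le> k" for j
      using orth[of j n 0] that \<open>k \<le> n\<close> by simp
  qed (rule int)
  have "(\<lambda>n. \<integral>x. x ^ k \<partial>M n) \<longlonglongrightarrow> jacobi_expansion \<omega> k 0" for k
    using moment by (intro tendsto_eventually) (auto simp: eventually_sequentially)
  from weak_limit_of_convergent_moments[OF rd int this] obtain s \<nu>
    where s: "strict_mono s" and rd\<nu>: "real_distribution \<nu>" and conv: "weak_conv_m (M \<circ> s) \<nu>"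
      and int\<nu>: "\<And>k. integrable \<nu> (\<lambda>x. x ^ k)"
      and mom\<nu>: "\<And>k. (\<integral>x. x ^ k \<partial>\<nu>) = jacobi_expansion \<omega> k 0" by blast
  have orth\<nu>: "(\<integral>x. poly (jacobi_poly \<omega> k) x * poly (jacobi_poly \<omega> l) x \<partial>\<nu>)
      = (if k = l then jacobi_norm \<omega> k else 0)" for k l
  proof -
    let ?f = "jacobi_poly \<omega> k * jacobi_poly \<omega> l"
    have "(\<integral>x. poly ?f x \<partial>\<nu>) = (\<integral>x. poly ?f x \<partial>M (k + l))"
      unfolding integral_poly[OF int\<nu>] integral_poly[OF int] mom\<nu>
      by (intro sum.cong) (auto simp: moment degree_mult_eq)
    then show ?thesis using orth[of k "k + l" l] by simp
  qed
  have "corresponds_to_jacobi \<nu> \<omega>"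
    unfolding corresponds_to_jacobi_def
  proof (intro conjI exI[of _ "jacobi_poly \<omega>"])
    show "infinite (measure_support \<nu>)"
      by (rule infinite_measure_support[OF rd\<nu> int\<nu> pos orth\<nu>])
    show "monic_orthogonal_polys \<nu> (jacobi_poly \<omega>)"
      using orth\<nu> by (simp add: monic_orthogonal_polys_def)
  qed (use rd\<nu> int\<nu> pos jacobi_poly_three_term in blast)+
  then show thesis using that s conv by blast
qed

text \<open>Favard's theorem with control of one atom. If the kernels at \<open>x0\<close> are bounded by \<open>K\<close>, the Gauss
measures with node \<open>x0\<close> all have mass at least \<open>1 / K\<close> there, and so has their weak limit. Of two
consecutive polynomials at least one does not vanish at \<open>x0\<close>, so such Gauss measures exist in
arbitrarily high order.\<close>

lemma corresponds_to_jacobi_exists_atom: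
  fixes \<omega> :: "nat \<Rightarrow> real"
  assumes pos: "\<forall>k\<ge>1. \<omega> k > 0"
  obtains \<nu> where "corresponds_to_jacobi \<nu> \<omega>"
    "\<And>K. (\<And>n. cd_kernel \<omega> n x0 x0 \<le> K) \<Longrightarrow> 1 / K \<le> measure \<nu> {x0}"
proof -
  have "\<exists>\<nu>. real_distribution \<nu> \<and> (\<forall>k. integrable \<nu> (\<lambda>x. x ^ k)) \<and>
      (\<forall>k l. k \<le> n \<longrightarrow> l \<le> n \<longrightarrow>
         (\<integral>x. poly (jacobi_poly \<omega> k) x * poly (jacobi_poly \<omega> l) x \<partial>\<nu>)
           = (if k = l then jacobi_norm \<omega> k else 0)) \<and>
      (\<exists>N. measure \<nu> {x0} = 1 / cd_kernel \<omega> N x0 x0)" for n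
  proof -
    obtain N where N: "n \<le> N" "poly (jacobi_poly \<omega> N) x0 \<noteq> 0"
      using jacobi_poly_no_common_root[OF pos, of n x0] by (metis le_SucI order_refl)
    from gauss_measure[OF pos N(2)] show ?thesis using N(1) by (smt (verit) order_trans)
  qed
  then obtain M where rd: "\<And>n. real_distribution (M n)"
    and int: "\<And>n k. integrable (M n) (\<lambda>x. x ^ k)"
    and orth: "\<And>n k l. k \<le> n \<Longrightarrow> l \<le> n \<Longrightarrow>
       (\<integral>x. poly (jacobi_poly \<omega> k) x * poly (jacobi_poly \<omega> l) x \<partial>M n)
         = (if k = l then jacobi_norm \<omega> k else 0)"
    and atom: "\<And>n. \<exists>N. measure (M n) {x0} = 1 / cd_kernel \<omega> N x0 x0" by metis
  obtain s \<nu> where conv: "weak_conv_m (M \<circ> s) \<nu>" and \<nu>: "corresponds_to_jacobi \<nu> \<omega>"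
    by (rule corresponds_to_jacobi_limit[of \<omega> M]) (use pos rd int orth in auto)
  show thesis
  proof (rule that[OF \<nu>])
    fix K assume K: "\<And>n. cd_kernel \<omega> n x0 x0 \<le> K"
    show "1 / K \<le> measure \<nu> {x0}"
    proof (rule weak_limit_atom[OF _ _ conv])
      show "real_distribution \<nu>" using \<nu> by (simp add: corresponds_to_jacobi_def)
      show "1 / K \<le> measure ((M \<circ> s) n) {x0}" for n
      proof -
        obtain N where N: "measure ((M \<circ> s) n) {x0} = 1 / cd_kernel \<omega> N x0 x0"
          using atom by auto
        have "0 < cd_kernel \<omega> N x0 x0" using cd_kernel_ge_1[OF pos, of N x0] by linarith
        then show ?thesis unfolding N using K[of N] by (intro divide_left_mono) auto
      qed
    qed (simp add: rd)
  qed
qed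

section \<open>Uniqueness for moments of at most factorial growth\<close>

abbreviation fourier_moment :: "real measure \<Rightarrow> nat \<Rightarrow> real \<Rightarrow> complex" where
  "fourier_moment \<mu> k t \<equiv> (CLINT x|\<mu>. of_real (x ^ k) * iexp (t * x))"

lemma integrable_fourier_moment:
  assumes "real_distribution \<mu>" and int: "\<And>k. integrable \<mu> (\<lambda>x. x ^ k)"
  shows "complex_integrable \<mu> (\<lambda>x. of_real (x ^ k) * iexp (t * x))"
proof -
  interpret real_distribution \<mu> by fact
  show ?thesis
    by (rule Bochner_Integration.integrable_bound[OF int[of k]])
       (auto simp: norm_mult norm_power power_abs)
qed

lemma fourier_moment_taylor:
  assumes "real_distribution \<mu>" and int: "\<And>k. integrable \<mu> (\<lambda>x. x ^ k)"
    and even: "even (k + Suc n)"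
  shows "cmod (fourier_moment \<mu> k (t + s)
             - (\<Sum>j\<le>n. (\<i> * of_real s) ^ j / fact j * fourier_moment \<mu> (k + j) t))
         \<le> \<bar>s\<bar> ^ Suc n / fact (Suc n) * (\<integral>x. x ^ (k + Suc n) \<partial>\<mu>)"
proof -
  define f where "f x = of_real (x ^ k) * iexp ((t + s) * x)
      - (\<Sum>j\<le>n. (\<i> * of_real s) ^ j / fact j * (of_real (x ^ (k + j)) * iexp (t * x)))" for x :: real
  note intF = integrable_fourier_moment[OF assms(1) int]
  have intS: "complex_integrable \<mu> (\<lambda>x. \<Sum>j\<le>n. (\<i> * of_real s) ^ j / fact j
      * (of_real (x ^ (k + j)) * iexp (t * x)))"
    by (intro Bochner_Integration.integrable_sum integrable_mult_right intF)
  have "(CLINT x|\<mu>. f x) = fourier_moment \<mu> k (t + s)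
      - (CLINT x|\<mu>. \<Sum>j\<le>n. (\<i> * of_real s) ^ j / fact j * (of_real (x ^ (k + j)) * iexp (t * x)))"
    unfolding f_def by (rule Bochner_Integration.integral_diff[OF intF intS])
  also have "(CLINT x|\<mu>. \<Sum>j\<le>n. (\<i> * of_real s) ^ j / fact j * (of_real (x ^ (k + j)) * iexp (t * x)))
      = (\<Sum>j\<le>n. CLINT x|\<mu>. (\<i> * of_real s) ^ j / fact j * (of_real (x ^ (k + j)) * iexp (t * x)))"
    by (intro Bochner_Integration.integral_sum integrable_mult_right intF)
  also have "\<dots> = (\<Sum>j\<le>n. (\<i> * of_real s) ^ j / fact j * fourier_moment \<mu> (k + j) t)"
    by (simp only: integral_mult_right_zero)
  finally have "fourier_moment \<mu> k (t + s)
      - (\<Sum>j\<le>n. (\<i> * of_real s) ^ j / fact j * fourier_moment \<mu> (k + j) t) = (CLINT x|\<mu>. f x)" ..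
  also have "cmod \<dots> \<le> (\<integral>x. \<bar>s\<bar> ^ Suc n / fact (Suc n) * x ^ (k + Suc n) \<partial>\<mu>)"
  proof (rule Bochner_Integration.integral_norm_bound_integral)
    show "complex_integrable \<mu> f" unfolding f_def
      by (intro Bochner_Integration.integrable_diff intF intS)
    show "integrable \<mu> (\<lambda>x. \<bar>s\<bar> ^ Suc n / fact (Suc n) * x ^ (k + Suc n))"
      by (intro integrable_mult_right int)
    fix x :: real
    have "f x = of_real (x ^ k) * iexp (t * x)
        * (iexp (s * x) - (\<Sum>j\<le>n. (\<i> * of_real (s * x)) ^ j / fact j))"
      by (simp add: f_def exp_add[symmetric] algebra_simps sum_distrib_left power_add
            power_mult_distrib)
    then have "cmod (f x) = \<bar>x\<bar> ^ k * cmod (iexp (s * x) - (\<Sum>j\<le>n. (\<i> * of_real (s * x)) ^ j / fact j))"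
      by (simp add: norm_mult norm_power del: of_real_mult)
    also have "\<dots> \<le> \<bar>x\<bar> ^ k * (\<bar>s * x\<bar> ^ Suc n / fact (Suc n))"
      by (intro mult_left_mono iexp_approx1) simp
    also have "\<dots> = \<bar>s\<bar> ^ Suc n / fact (Suc n) * \<bar>x\<bar> ^ (k + Suc n)"
      by (simp add: abs_mult power_mult_distrib power_add)
    also have "\<bar>x\<bar> ^ (k + Suc n) = x ^ (k + Suc n)" using even by (rule power_even_abs)
    finally show "cmod (f x) \<le> \<bar>s\<bar> ^ Suc n / fact (Suc n) * x ^ (k + Suc n)" .
  qed
  finally show ?thesis by simp
qed

lemma fact_add_le: "fact (n + k) \<le> (fact n * fact k * 2 ^ (n + k) :: real)"
proof -
  have "(n + k) choose k \<le> (\<Sum>i\<le>n + k. (n + k) choose i)"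
    by (rule member_le_sum) auto
  then have "real ((n + k) choose k) \<le> 2 ^ (n + k)"
    unfolding choose_row_sum by (metis of_nat_le_iff of_nat_numeral of_nat_power)
  then have "fact n * fact k * real ((n + k) choose k) \<le> fact n * fact k * 2 ^ (n + k)"
    by (intro mult_left_mono) auto
  then show ?thesis using binomial_fact[of k "n + k", where 'a = real] by simp
qed

text \<open>The Taylor polynomials of \<open>s \<mapsto> \<integral> x\<^sup>k exp(i (t + s) x)\<close> at \<open>s = 0\<close> are built from the functions
\<open>\<integral> x\<^sup>k\<^sup>+\<^sup>j exp(i t x)\<close>, which the two measures share. For moments of factorial growth the remainder
tends to zero for small \<open>s\<close>, and how small does not depend on \<open>t\<close>. Keeping track of all \<open>k\<close> is what
allows the step to be repeated.\<close>

lemma fourier_moment_propagate: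
  assumes rd: "real_distribution \<mu>" "real_distribution \<nu>"
    and int: "\<And>k. integrable \<mu> (\<lambda>x. x ^ k)" "\<And>k. integrable \<nu> (\<lambda>x. x ^ k)"
    and eq: "\<And>k. (\<integral>x. x ^ k \<partial>\<mu>) = (\<integral>x. x ^ k \<partial>\<nu>)"
    and bound: "\<And>k. (\<integral>x. x ^ k \<partial>\<mu>) \<le> C ^ k * fact k" and C: "C > 0"
    and s: "\<bar>s\<bar> * C \<le> 1 / 4"
    and t: "\<And>k. fourier_moment \<mu> k t = fourier_moment \<nu> k t"
  shows "fourier_moment \<mu> k (t + s) = fourier_moment \<nu> k (t + s)"
proof -
  define D where "D = cmod (fourier_moment \<mu> k (t + s) - fourier_moment \<nu> k (t + s))"
  have le: "D \<le> 2 * (2 * C) ^ k * fact k * (1 / 2) ^ m" for m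
  proof -
    \<comment> \<open>\<open>Suc n\<close> has the parity of \<open>k\<close>, so that the remainder involves an even moment.\<close>
    define n where "n = Suc (2 * m + k)"
    have even: "even (k + Suc n)" by (simp add: n_def)
    define a where "a = \<bar>s\<bar> ^ Suc n / fact (Suc n) * (\<integral>x. x ^ (k + Suc n) \<partial>\<mu>)"
    define S where "S = (\<Sum>j\<le>n. (\<i> * of_real s) ^ j / fact j * fourier_moment \<mu> (k + j) t)"
    have "cmod (fourier_moment \<mu> k (t + s) - S) \<le> a"
      unfolding S_def a_def by (rule fourier_moment_taylor[OF rd(1) int(1) even])
    moreover have "cmod (fourier_moment \<nu> k (t + s) - S) \<le> a"
      unfolding S_def a_def eq t by (rule fourier_moment_taylor[OF rd(2) int(2) even])
    moreover have "D \<le> cmod (fourier_moment \<mu> k (t + s) - S) + cmod (fourier_moment \<nu> k (t + s) - S)"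
      using norm_triangle_ineq4[of "fourier_moment \<mu> k (t + s) - S" "fourier_moment \<nu> k (t + s) - S"]
      unfolding D_def by (simp only: diff_diff_eq2 diff_add_cancel)
    ultimately have "D \<le> a + a" by linarith
    have "a \<le> \<bar>s\<bar> ^ Suc n / fact (Suc n) * (C ^ (k + Suc n) * fact (Suc n + k))"
      unfolding a_def using bound[of "k + Suc n"] by (intro mult_left_mono) (simp_all add: add.commute)
    also have "\<dots> \<le> \<bar>s\<bar> ^ Suc n / fact (Suc n)
        * (C ^ (k + Suc n) * (fact (Suc n) * fact k * 2 ^ (Suc n + k)))"
      using C fact_add_le[of "Suc n" k] by (intro mult_left_mono) auto
    also have "\<dots> = (2 * C) ^ k * fact k * (2 * (\<bar>s\<bar> * C)) ^ Suc n"
    proof -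
      have *: "\<sigma> ^ N / F * (C ^ (k + N) * (F * fact k * 2 ^ (N + k)))
          = (2 * C) ^ k * fact k * (2 * (\<sigma> * C)) ^ N" if "F \<noteq> 0" for F \<sigma> :: real and N
        using that by (simp add: power_add power_mult_distrib)
      show ?thesis by (rule *) simp
    qed
    also have "\<dots> \<le> (2 * C) ^ k * fact k * (1 / 2) ^ Suc n"
      using s C by (intro mult_left_mono power_mono) auto
    also have "\<dots> \<le> (2 * C) ^ k * fact k * (1 / 2) ^ m"
      using C by (intro mult_left_mono power_decreasing) (auto simp: n_def)
    finally show ?thesis using \<open>D \<le> a + a\<close> by simp
  qed
  have "(\<lambda>m. 2 * (2 * C) ^ k * fact k * (1 / 2) ^ m) \<longlonglongrightarrow> 2 * (2 * C) ^ k * fact k * 0"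
    by (intro tendsto_intros LIMSEQ_power_zero) simp
  then have "D \<le> 2 * (2 * C) ^ k * fact k * 0"
    by (rule LIMSEQ_le_const) (use le in auto)
  then show ?thesis by (simp add: D_def)
qed

text \<open>Equality of the characteristic functions spreads from \<open>0\<close> to any \<open>t\<close> in finitely many steps of
bounded length.\<close>

lemma moment_determinate:
  assumes rd: "real_distribution \<mu>" "real_distribution \<nu>"
    and int: "\<And>k. integrable \<mu> (\<lambda>x. x ^ k)" "\<And>k. integrable \<nu> (\<lambda>x. x ^ k)"
    and eq: "\<And>k. (\<integral>x. x ^ k \<partial>\<mu>) = (\<integral>x. x ^ k \<partial>\<nu>)"
    and bound: "\<And>k. (\<integral>x. x ^ k \<partial>\<mu>) \<le> C ^ k * fact k" and C: "C > 0"
  shows "\<mu> = \<nu>"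
proof (rule Levy_uniqueness[OF rd], rule ext)
  fix t :: real
  obtain N where N: "real N > 4 * \<bar>t\<bar> * C" using reals_Archimedean2 by blast
  have "4 * \<bar>t\<bar> * C \<ge> 0" using C by simp
  then have N0: "N > 0" using N by (cases N) auto
  define s where "s = t / N"
  have s: "\<bar>s\<bar> * C \<le> 1 / 4" using N N0 by (simp add: s_def field_simps)
  have "\<forall>k. fourier_moment \<mu> k (real i * s) = fourier_moment \<nu> k (real i * s)" for i
  proof (induction i)
    case 0
    have "fourier_moment \<rho> k (real 0 * s) = of_real (\<integral>x. x ^ k \<partial>\<rho>)" for \<rho> k
      by (simp flip: of_real_power)
    then show ?case using eq by simp
  next
    case (Suc i)
    then have "fourier_moment \<mu> k (real i * s + s) = fourier_moment \<nu> k (real i * s + s)" for k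
      by (intro fourier_moment_propagate[OF rd int eq bound C s]) auto
    then show ?case by (simp add: algebra_simps)
  qed
  from spec[OF this[of N], of 0] N0 have "fourier_moment \<mu> 0 t = fourier_moment \<nu> 0 t" by (simp add: s_def)
  then show "char \<mu> t = char \<nu> t" by (simp add: char_def)
qed

text \<open>The induction step from \<open>n\<close> to \<open>n + 1\<close> produces the factor \<open>k + (k + 1)\<close>, because division by
\<open>(k + 1)!\<close> absorbs one of the two factors \<open>k + 1\<close> in \<open>\<omega>\<^sub>k\<^sub>+\<^sub>1 \<le> (k + 1)\<^sup>2\<close>. The factor is at most
\<open>3 (n + 1)\<close>, since only \<open>k \<le> n + 1\<close> matters.\<close>

lemma jacobi_expansion_bound:
  fixes \<omega> :: "nat \<Rightarrow> real"
  assumes \<omega>: "\<forall>k\<ge>1. 0 \<le> \<omega> k \<and> \<omega> k \<le> (real k)\<^sup>2"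
  shows "0 \<le> jacobi_expansion \<omega> n k \<and> jacobi_expansion \<omega> n k \<le> 3 ^ n * fact n / fact k"
proof (induction n arbitrary: k)
  case 0 show ?case by auto
next
  case (Suc n)
  let ?c = "jacobi_expansion \<omega> n" and ?A = "3 ^ n * fact n :: real"
  have w: "0 \<le> \<omega> (Suc k)" "\<omega> (Suc k) \<le> (real (Suc k))\<^sup>2" using \<omega> by auto
  have nonneg: "0 \<le> jacobi_expansion \<omega> (Suc n) k" using Suc.IH w by simp
  show ?case
  proof (cases "k \<le> Suc n")
    case False
    then show ?thesis by (simp add: jacobi_expansion_eq_0 del: jacobi_expansion.simps)
  next
    case True
    have lower: "(if k = 0 then 0 else ?c (k - 1)) \<le> ?A * real k / fact k"
    proof (cases k)
      case (Suc j)
      have "?A * real k / fact k = ?A / fact j" unfolding Suc by (simp del: of_nat_Suc)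
      then show ?thesis using Suc.IH[of j] Suc by simp
    qed simp
    have "\<omega> (Suc k) * ?c (Suc k) \<le> (real (Suc k))\<^sup>2 * (?A / fact (Suc k))"
      using Suc.IH[of "Suc k"] w by (intro mult_mono) auto
    also have "\<dots> = ?A * real (Suc k) / fact k"
      by (simp add: power2_eq_square del: of_nat_Suc)
    finally have upper: "\<omega> (Suc k) * ?c (Suc k) \<le> ?A * real (Suc k) / fact k" .
    have "jacobi_expansion \<omega> (Suc n) k \<le> ?A * real k / fact k + ?A * real (Suc k) / fact k"
      unfolding jacobi_expansion.simps by (rule add_mono[OF lower upper])
    also have "\<dots> = ?A * real (2 * k + 1) / fact k"
      by (simp add: add_divide_distrib[symmetric] algebra_simps)
    also have "\<dots> \<le> ?A * (3 * real (Suc n)) / fact k"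
      using True by (intro divide_right_mono mult_left_mono) auto
    also have "?A * (3 * real (Suc n)) = 3 ^ Suc n * fact (Suc n)"
      by (simp del: of_nat_Suc)
    finally show ?thesis using nonneg by simp
  qed
qed

theorem corresponds_to_jacobi_unique:
  assumes \<omega>: "\<forall>k\<ge>1. \<omega> k \<le> (real k)\<^sup>2"
    and \<mu>: "corresponds_to_jacobi \<mu> \<omega>" and \<nu>: "corresponds_to_jacobi \<nu> \<omega>"
  shows "\<mu> = \<nu>"
proof (rule moment_determinate[where C = 3])
  have "\<forall>k\<ge>1. 0 \<le> \<omega> k \<and> \<omega> k \<le> (real k)\<^sup>2"
    using \<mu> \<omega> by (auto simp: corresponds_to_jacobi_def less_imp_le)
  from jacobi_expansion_bound[OF this, of _ 0]
  show "(\<integral>x. x ^ k \<partial>\<mu>) \<le> 3 ^ k * fact k" for k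
    by (simp add: corresponds_to_jacobi_moments[OF \<mu>])
qed (use \<mu> \<nu> in \<open>simp_all add: corresponds_to_jacobi_moments, simp_all add: corresponds_to_jacobi_def\<close>)

section \<open>Non-uniqueness for log-concave Jacobi sequences of fast growth\<close>

text \<open>The maximum of two consecutive terms grows by at most the factor \<open>1 + e n \<le> exp (e n)\<close> per step.\<close>

lemma perturbed_two_step_bounded:
  fixes r e :: "nat \<Rightarrow> real"
  assumes r: "\<And>n. r n \<ge> 0" and e: "\<And>n. e n \<ge> 0" "summable e"
    and rec: "\<And>n. r (Suc (Suc n)) \<le> r n + e n * r (Suc n)"
  obtains R where "\<And>n. r n \<le> R"
proof -
  define R0 where "R0 = max (r 0) (r 1)"
  have R0: "R0 \<ge> 0" using r[of 0] by (simp add: R0_def)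
  have step: "max (r n) (r (Suc n)) \<le> R0 * exp (\<Sum>i<n. e i)" for n
  proof (induction n)
    case (Suc n)
    let ?B = "R0 * exp (\<Sum>i<n. e i)"
    have B: "r n \<le> ?B" "r (Suc n) \<le> ?B" using Suc by auto
    have "r (Suc (Suc n)) \<le> ?B + e n * ?B"
      using rec[of n] B mult_left_mono[OF B(2) e(1)[of n]] by linarith
    also have "\<dots> = ?B * (1 + e n)" by (simp add: algebra_simps)
    also have "\<dots> \<le> ?B * exp (e n)" using R0 by (intro mult_left_mono exp_ge_add_one_self) auto
    finally have 1: "r (Suc (Suc n)) \<le> ?B * exp (e n)" .
    have "?B * 1 \<le> ?B * exp (e n)" using R0 e(1)[of n] by (intro mult_left_mono) auto
    then have "r (Suc n) \<le> ?B * exp (e n)" using B by linarith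
    with 1 show ?case by (simp add: exp_add mult.assoc)
  qed (simp add: R0_def)
  have "r n \<le> R0 * exp (suminf e)" for n
  proof -
    have "r n \<le> R0 * exp (\<Sum>i<n. e i)" using step[of n] by simp
    also have "\<dots> \<le> R0 * exp (suminf e)"
      using R0 e by (intro mult_left_mono) (auto intro: sum_le_suminf)
    finally show ?thesis .
  qed
  then show thesis by (rule that)
qed

text \<open>With \<open>b\<^sub>k = sqrt \<omega>\<^sub>k\<close>, the orthonormal polynomials \<open>q\<^sub>k\<close> at \<open>x\<close> have size \<open>O(1 / sqrt b\<^sub>k\<^sub>+\<^sub>1)\<close>: after rescaling by
\<open>sqrt b\<^sub>k\<^sub>+\<^sub>1\<close>, the three-term recurrence bounds a term by the one two places before it, with a
coefficient that is at most \<open>1\<close> by log-concavity, plus a perturbation of relative size \<open>O(1 / b\<^sub>k)\<close>.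
Hence the kernel, a sum of \<open>q\<^sub>k\<^sup>2\<close>, is dominated by the convergent series of the \<open>1 / b\<^sub>k\<close>. This is
Berezanskii's criterion.\<close>

lemma cd_kernel_bounded:
  fixes \<omega> :: "nat \<Rightarrow> real"
  assumes pos: "\<forall>k\<ge>1. \<omega> k > 0"
    and concave: "\<forall>k\<ge>1. \<omega> k * \<omega> (k + 2) \<le> (\<omega> (k + 1))\<^sup>2"
    and summable: "summable (\<lambda>k. 1 / sqrt (\<omega> (Suc k)))"
  obtains K where "\<And>n. cd_kernel \<omega> n x x \<le> K"
proof -
  define b where "b k = sqrt (\<omega> k)" for k
  define g where "g k = sqrt (b k)" for k
  define H where "H k = sqrt (jacobi_norm \<omega> k)" for k
  define u where "u k = poly (jacobi_poly \<omega> k) x" for k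
  define q where "q k = \<bar>u k\<bar> / H k" for k
  define r where "r k = q k * g (Suc k)" for k
  define c where "c = \<bar>x\<bar> * (g 2 / g 1)"
  have b: "b (Suc k) > 0" for k using pos by (simp add: b_def)
  have g: "g (Suc k) > 0" for k using b by (simp add: g_def)
  have gg: "g (Suc k) * g (Suc k) = b (Suc k)" for k using b[of k] by (simp add: g_def)
  have bb: "b (Suc k) * b (Suc k) = \<omega> (Suc k)" for k
    using pos by (simp add: b_def less_imp_le)
  have H: "H k > 0" and HS: "H (Suc k) = b (Suc k) * H k" for k
    using jacobi_norm_pos[OF pos] by (simp_all add: H_def b_def real_sqrt_mult)
  have g_concave: "g (Suc k) * g (Suc (Suc (Suc k))) \<le> g (Suc (Suc k)) * g (Suc (Suc k))" for k
  proof -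
    have "\<omega> (Suc k) * \<omega> (Suc (Suc (Suc k))) \<le> \<omega> (Suc (Suc k)) * \<omega> (Suc (Suc k))"
      using concave[rule_format, of "Suc k"] by (simp add: power2_eq_square)
    then have "sqrt (sqrt (\<omega> (Suc k) * \<omega> (Suc (Suc (Suc k)))))
        \<le> sqrt (sqrt (\<omega> (Suc (Suc k)) * \<omega> (Suc (Suc k))))"
      by (intro real_sqrt_le_mono)
    then show ?thesis by (simp only: g_def b_def real_sqrt_mult)
  qed
  \<comment> \<open>Quotients of consecutive terms of a log-concave sequence decrease; this bounds the perturbation.\<close>
  have ratio: "g (Suc (Suc k)) / g (Suc k) \<le> g 2 / g 1" for k
  proof (induction k)
    case (Suc k)
    have "g (Suc (Suc (Suc k))) / g (Suc (Suc k)) \<le> g (Suc (Suc k)) / g (Suc k)"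
      using g_concave[of k] g by (simp add: field_simps)
    then show ?case using Suc by linarith
  qed (simp add: numeral_2_eq_2)
  have q_rec: "q (Suc (Suc k)) \<le> (\<bar>x\<bar> * q (Suc k) + b (Suc k) * q k) / b (Suc (Suc k))" for k
  proof -
    have "u (Suc (Suc k)) = x * u (Suc k) - b (Suc k) * b (Suc k) * u k"
      by (simp add: u_def bb)
    then have "\<bar>u (Suc (Suc k))\<bar> \<le> \<bar>x\<bar> * \<bar>u (Suc k)\<bar> + b (Suc k) * b (Suc k) * \<bar>u k\<bar>"
      using abs_triangle_ineq4[of "x * u (Suc k)" "b (Suc k) * b (Suc k) * u k"]
      by (simp add: abs_mult)
    then have "q (Suc (Suc k)) \<le> (\<bar>x\<bar> * \<bar>u (Suc k)\<bar> + b (Suc k) * b (Suc k) * \<bar>u k\<bar>) / H (Suc (Suc k))"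
      unfolding q_def using H[of "Suc (Suc k)"] by (intro divide_right_mono) auto
    also have "\<dots> = (\<bar>x\<bar> * q (Suc k) + b (Suc k) * q k) / b (Suc (Suc k))"
      using b[of k] b[of "Suc k"] H[of k] by (simp add: q_def HS field_simps)
    finally show ?thesis .
  qed
  have q0: "q k \<ge> 0" for k using H[of k] by (simp add: q_def)
  have r0: "r k \<ge> 0" for k using q0[of k] g[of k] by (simp add: r_def)
  have c0: "c \<ge> 0" using g[of 0] g[of 1] by (simp add: c_def numeral_2_eq_2)
  have r_rec: "r (Suc (Suc k)) \<le> r k + c / b (Suc (Suc k)) * r (Suc k)" for k
  proof -
    let ?g1 = "g (Suc k)" and ?g2 = "g (Suc (Suc k))" and ?g3 = "g (Suc (Suc (Suc k)))"
    have "r (Suc (Suc k)) \<le> (\<bar>x\<bar> * q (Suc k) + b (Suc k) * q k) / b (Suc (Suc k)) * ?g3"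
      unfolding r_def using q_rec[of k] g[of "Suc (Suc k)"] by (intro mult_right_mono) auto
    also have "\<dots> = (\<bar>x\<bar> * (?g3 / ?g2)) / b (Suc (Suc k)) * r (Suc k) + (?g1 * ?g3) / (?g2 * ?g2) * r k"
      using g[of k] g[of "Suc k"] by (simp add: r_def gg[symmetric] field_simps)
    also have "\<dots> \<le> c / b (Suc (Suc k)) * r (Suc k) + 1 * r k"
    proof (intro add_mono mult_right_mono divide_right_mono r0)
      show "\<bar>x\<bar> * (?g3 / ?g2) \<le> c"
        unfolding c_def using ratio[of "Suc k"] by (intro mult_left_mono) auto
      show "(?g1 * ?g3) / (?g2 * ?g2) \<le> 1"
        using g_concave[of k] g[of "Suc k"] by (simp add: divide_le_eq)
    qed (use b in \<open>auto intro: less_imp_le\<close>)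
    finally show ?thesis by simp
  qed
  have summable_b: "summable (\<lambda>k. 1 / b (Suc k))" using summable by (simp add: b_def)
  have "summable (\<lambda>k. 1 / b (Suc (Suc k)))"
    using summable_b by (subst summable_Suc_iff)
  then have "summable (\<lambda>k. c * (1 / b (Suc (Suc k))))" by (rule summable_mult)
  then have "summable (\<lambda>k. c / b (Suc (Suc k)))" by simp
  moreover have "c / b (Suc (Suc k)) \<ge> 0" for k using c0 b[of "Suc k"] by simp
  ultimately obtain R where R: "\<And>k. r k \<le> R"
    using perturbed_two_step_bounded[of r "\<lambda>k. c / b (Suc (Suc k))"] r0 r_rec by blast
  have "cd_kernel \<omega> n x x \<le> R\<^sup>2 * (\<Sum>k. 1 / b (Suc k))" for n
  proof -
    have "cd_kernel \<omega> n x x = (\<Sum>k\<le>n. (r k)\<^sup>2 * (1 / b (Suc k)))"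
      unfolding cd_kernel_def
    proof (rule sum.cong)
      fix k
      have "jacobi_norm \<omega> k = (H k)\<^sup>2"
        using jacobi_norm_pos[OF pos, of k] by (simp add: H_def less_imp_le)
      then show "poly (jacobi_poly \<omega> k) x * poly (jacobi_poly \<omega> k) x / jacobi_norm \<omega> k
          = (r k)\<^sup>2 * (1 / b (Suc k))"
        using g[of k] by (simp add: r_def q_def u_def gg[symmetric] power2_eq_square)
    qed simp
    also have "\<dots> \<le> (\<Sum>k\<le>n. R\<^sup>2 * (1 / b (Suc k)))"
      using R r0 b by (intro sum_mono mult_right_mono power_mono) (auto intro: less_imp_le)
    also have "\<dots> = R\<^sup>2 * (\<Sum>k\<le>n. 1 / b (Suc k))" by (simp add: sum_distrib_left)
    also have "\<dots> \<le> R\<^sup>2 * (\<Sum>k. 1 / b (Suc k))"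
      using summable_b b by (intro mult_left_mono sum_le_suminf) (auto intro: less_imp_le)
    finally show ?thesis .
  qed
  then show thesis by (rule that)
qed

text \<open>A unique measure would have to coincide, for each real \<open>x\<close>, with a solution that has an atom
at \<open>x\<close>, but a finite measure has only countably many atoms.\<close>

theorem corresponds_to_jacobi_not_unique:
  assumes pos: "\<forall>k\<ge>1. \<omega> k > 0"
    and concave: "\<forall>k\<ge>1. \<omega> k * \<omega> (k + 2) \<le> (\<omega> (k + 1))\<^sup>2"
    and summable: "summable (\<lambda>k. 1 / sqrt (\<omega> (Suc k)))"
  shows "\<not> (\<exists>!\<mu>. corresponds_to_jacobi \<mu> \<omega>)"
proof
  assume "\<exists>!\<mu>. corresponds_to_jacobi \<mu> \<omega>"
  then obtain \<mu> where \<mu>: "corresponds_to_jacobi \<mu> \<omega>"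
    and uniq: "\<And>\<nu>. corresponds_to_jacobi \<nu> \<omega> \<Longrightarrow> \<nu> = \<mu>" by blast
  interpret real_distribution \<mu> using \<mu> by (simp add: corresponds_to_jacobi_def)
  have "measure \<mu> {x} \<noteq> 0" for x
  proof -
    obtain K where K: "\<And>n. cd_kernel \<omega> n x x \<le> K"
      using cd_kernel_bounded[OF pos concave summable] by blast
    have "0 < K" using cd_kernel_ge_1[OF pos, of 0 x] K[of 0] by linarith
    moreover obtain \<nu> where "corresponds_to_jacobi \<nu> \<omega>" "1 / K \<le> measure \<nu> {x}"
      using corresponds_to_jacobi_exists_atom[OF pos, of x] K by blast
    ultimately show ?thesis using uniq by (metis less_le_trans less_irrefl zero_less_divide_1_iff)
  qed
  then have "{x. measure \<mu> {x} \<noteq> 0} = UNIV" by auto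
  then show False using countable_support uncountable_UNIV_real by simp
qed

section \<open>The power sequences\<close>

theorem theorem1p2:
  fixes p :: real
  assumes "p > 0"
  shows "(\<exists>\<mu>. corresponds_to_jacobi \<mu> (\<lambda>n. real n powr p)) \<and>
         ((\<exists>!\<mu>. corresponds_to_jacobi \<mu> (\<lambda>n. real n powr p)) \<longleftrightarrow> p \<le> 2)"
proof -
  let ?\<omega> = "\<lambda>n. real n powr p"
  have pos: "\<forall>k\<ge>1. ?\<omega> k > 0" by simp
  obtain \<mu> where \<mu>: "corresponds_to_jacobi \<mu> ?\<omega>"
    using corresponds_to_jacobi_exists_atom[OF pos] by blast
  have "\<exists>!\<mu>. corresponds_to_jacobi \<mu> ?\<omega>" if p: "p \<le> 2"
  proof -
    have "real k powr p \<le> (real k)\<^sup>2" if "k \<ge> 1" for k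
      using powr_mono[OF p, of "real k"] that by (simp add: powr_numeral)
    then show ?thesis using \<mu> corresponds_to_jacobi_unique[of ?\<omega>] by blast
  qed
  moreover have "\<not> (\<exists>!\<mu>. corresponds_to_jacobi \<mu> ?\<omega>)" if p: "\<not> p \<le> 2"
  proof (rule corresponds_to_jacobi_not_unique[OF pos])
    have "real k powr p * real (k + 2) powr p \<le> (real (k + 1) powr p)\<^sup>2" for k
    proof -
      have "real k powr p * real (k + 2) powr p = (real k * real (k + 2)) powr p"
        by (simp add: powr_mult)
      also have "\<dots> \<le> (real (k + 1) * real (k + 1)) powr p"
        using assms by (intro powr_mono2) (auto simp: algebra_simps)
      also have "\<dots> = (real (k + 1) powr p)\<^sup>2" by (simp add: powr_mult power2_eq_square)
      finally show ?thesis .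
    qed
    then show "\<forall>k\<ge>1. ?\<omega> k * ?\<omega> (k + 2) \<le> (?\<omega> (k + 1))\<^sup>2" by blast
    have "summable (\<lambda>n. real n powr (- p / 2))" using p by (simp add: summable_real_powr_iff)
    then have "summable (\<lambda>k. real (Suc k) powr (- p / 2))" by (subst summable_Suc_iff)
    moreover have "1 / sqrt (?\<omega> (Suc k)) = real (Suc k) powr (- p / 2)" for k
      by (simp add: powr_half_sqrt[symmetric] powr_powr powr_minus_divide)
    ultimately show "summable (\<lambda>k. 1 / sqrt (?\<omega> (Suc k)))" by simp
  qed
  ultimately show ?thesis using \<mu> by blast
qed

end
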